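(* Let $G$ be a groupoid and let $A=K(G)$ be the algebra of complex functions with finite support on $G$ (pointwise operations). Define $\Delta$ on $A$ by $\Delta(f)(p,q)=f(pq)$ if $p,q\in G$ and $pq$ is defined, and $\Delta(f)(p,q)=0$ otherwise. Then $(A,\Delta)$ is a weak multiplier Hopf algebra. Its antipode is given by $S(f)(p)=f(p^{-1})$ for all $f\in A$ and $p\in G$.
   Context: A groupoid $G$ is a set with a partially defined associative product and inverses; each $p\in G$ has a source $s(p)$ and a target $t(p)$, which are units (the units are regarded as elements of $G$), and $pq$ is defined iff $s(p)=t(q)$. Here $A\otimes A$ is identified with $K(G\times G)$ and $M(A\otimes A)$ with the algebra $C(G\times G)$ of all complex functions on $G\times G$. General conventions. Algebras are associative over $\mathbb C$, not necessarily unital, with non-degenerate product ($ab=0$ for all $b$ implies $a=0$, and $ba=0$ for all $b$ implies $a=0$). $M(A)$ is the multiplier algebra; $L(A)$ is the algebra of left multipliers (linear $\lambda:A\to A$ with $\lambda(ab)=\lambda(a)b$), and one writes $\lambda a$ for $\lambda(a)$. $\iota$ is the identity map. Expressions such as $XY$ for subspaces denote linear spans of products. A coproduct on $A$ is a homomorphism $\Delta:A\to M(A\otimes A)$ with $\Delta(a)(1\otimes b)\in A\otimes A$ and $(a\otimes 1)\Delta(b)\in A\otimes A$ for all $a,b$, and $(a\otimes1\otimes1)(\Delta\otimes\iota)(\Delta(b)(1\otimes c))=(\iota\otimes\Delta)((a\otimes1)\Delta(b))(1\otimes1\otimes c)$ for all $a,b,c\in A$. It is full if the smallest subspaces $V,W\subseteq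 A$ with $\Delta(A)(1\otimes A)\subseteq V\otimes A$ and $(A\otimes1)\Delta(A)\subseteq A\otimes W$ are both equal to $A$. A counit is a linear map $\varepsilon:A\to\mathbb C$ with $(\varepsilon\otimes\iota)(\Delta(a)(1\otimes b))=ab$ and $(\iota\otimes\varepsilon)((a\otimes1)\Delta(b))=ab$ for all $a,b$ (unique when $\Delta$ is full). Put $T_1(a\otimes b)=\Delta(a)(1\otimes b)$ and $T_2(a\otimes b)=(a\otimes1)\Delta(b)$, linear maps $A\otimes A\to A\otimes A$. Weak multiplier Hopf algebra: a pair $(A,\Delta)$ where $A$ is non-degenerate and idempotent ($A^2=A$), $\Delta$ is a full coproduct with a counit $\varepsilon$, and the following hold. (1) There is an idempotent $E\in M(A\otimes A)$ with $\mathrm{Ran}(T_1)=E(A\otimes A)$ and $\mathrm{Ran}(T_2)=(A\otimes A)E$. (Then $E$ is unique, and $\Delta\otimes\iota$ and $\iota\otimes\Delta$ extend uniquely to homomorphisms $M(A\otimes A)\to M(A\otimes A\otimes A)$ sending $1$ to $E\otimes1$ and to $1\otimes E$, respectively.) (2) $(\iota\otimes\Delta)(E)=(\Delta\otimes\iota)(E)=(1\otimes E)(E\otimes1)=(E\otimes1)(1\otimes E)$. (3) There are a right multiplier $F_1$ of $A\otimes A^{\mathrm{op}}$ and a left multiplier $F_2$ of $A^{\mathrm{op}}\otimes A$, i.e. linear maps $A\otimes A\to A\otimes A$, $a\otimes b\mapsto (a\otimes1)F_i(1\otimes b)$, satisfying $(a'a\otimes1)F_i(1\otimes bb')=(a'\otimes1)\big((a\otimes1)F_i(1\otimes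 b)\big)(1\otimes b')$, such that $E_{13}(F_1\otimes1)=E_{13}(1\otimes E)$ and $(1\otimes F_2)E_{13}=(E\otimes1)E_{13}$. Explicitly, for all $a,b,c,d\in A$: if $(a\otimes c)E=\sum_i p_i\otimes q_i$, then $\sum_i (p_i\otimes1)F_1(1\otimes b)\otimes q_id=\sum_i p_i\otimes(1\otimes q_i)E(b\otimes d)$; and if $E(a\otimes c)=\sum_i p_i\otimes q_i$, then $\sum_i dp_i\otimes(b\otimes1)F_2(1\otimes q_i)=\sum_i (d\otimes b)E(p_i\otimes1)\otimes q_i$. (4) $\mathrm{Ker}(T_1)=(A\otimes1)(1-F_1)(1\otimes A)$ and $\mathrm{Ker}(T_2)=(A\otimes1)(1-F_2)(1\otimes A)$. The elements $E,F_1,F_2$ are uniquely determined by $\Delta$. Antipode: let $R_1$ be the unique linear map on $A\otimes A$ with $T_1R_1T_1=T_1$, $R_1T_1R_1=R_1$, $T_1R_1(a\otimes b)=E(a\otimes b)$ and $R_1T_1(a\otimes b)=(a\otimes1)F_1(1\otimes b)$. The antipode $S$ is determined by $S(a)b=(\varepsilon\otimes\iota)R_1(a\otimes b)$ for $a,b\in A$ (a priori $S(a)\in L(A)$). *)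

theory Defs
  imports Complex_Main "HOL-Library.Function_Algebras"
begin

section \<open>Complex algebras\<close>

text \<open>
  An algebra is a subset A of an ambient type of class \<open>complex_algebra\<close> (associative, not
  necessarily unital) that is a linear subspace closed under the product. Taking
  \<open>A = UNIV\<close> shows that this covers every associative algebra over the complex numbers.
\<close>

class complex_algebra = ring +
  fixes scaleC :: "complex \<Rightarrow> 'a \<Rightarrow> 'a" (infixr "*\<^sub>C" 75)
  assumes scaleC_add_right: "c *\<^sub>C (x + y) = c *\<^sub>C x + c *\<^sub>C y"
    and scaleC_add_left: "(c + d) *\<^sub>C x = c *\<^sub>C x + d *\<^sub>C x"
    and scaleC_scaleC: "c *\<^sub>C (d *\<^sub>C x) = (c * d) *\<^sub>C x"
    and scaleC_one: "1 *\<^sub>C x = x"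
    and mult_scaleC_left: "(c *\<^sub>C x) * y = c *\<^sub>C (x * y)"
    and mult_scaleC_right: "x * (c *\<^sub>C y) = c *\<^sub>C (x * y)"

instantiation complex :: complex_algebra
begin
definition scaleC_complex :: "complex \<Rightarrow> complex \<Rightarrow> complex"
  where "scaleC_complex c x = c * x"
instance
  by standard (simp_all add: scaleC_complex_def algebra_simps)
end

instantiation "fun" :: (type, complex_algebra) complex_algebra
begin
definition scaleC_fun :: "complex \<Rightarrow> ('a \<Rightarrow> 'b) \<Rightarrow> 'a \<Rightarrow> 'b"
  where "scaleC_fun c f = (\<lambda>x. c *\<^sub>C f x)"
instance
  by standard (simp_all add: scaleC_fun_def fun_eq_iff scaleC_add_right scaleC_add_left
      scaleC_scaleC scaleC_one mult_scaleC_left mult_scaleC_right)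
end

global_interpretation cvec: vector_space "scaleC :: complex \<Rightarrow> 'a \<Rightarrow> 'a::complex_algebra"
  by standard (simp_all add: scaleC_add_right scaleC_add_left scaleC_scaleC scaleC_one)

definition linear_on :: "'a::complex_algebra set \<Rightarrow> 'b::complex_algebra set \<Rightarrow> ('a \<Rightarrow> 'b) \<Rightarrow> bool"
  where "linear_on V W f \<longleftrightarrow>
    (\<forall>x\<in>V. f x \<in> W) \<and> (\<forall>x\<in>V. \<forall>y\<in>V. f (x + y) = f x + f y) \<and>
    (\<forall>c. \<forall>x\<in>V. f (c *\<^sub>C x) = c *\<^sub>C f x)"

definition bilinear_on ::
    "'a::complex_algebra set \<Rightarrow> 'b::complex_algebra set \<Rightarrow> ('a \<Rightarrow> 'a \<Rightarrow> 'b) \<Rightarrow> bool"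
  where "bilinear_on V W \<beta> \<longleftrightarrow>
    (\<forall>a\<in>V. linear_on V W (\<beta> a)) \<and> (\<forall>b\<in>V. linear_on V W (\<lambda>a. \<beta> a b))"

definition trilinear_on ::
    "'a::complex_algebra set \<Rightarrow> 'b::complex_algebra set \<Rightarrow> ('a \<Rightarrow> 'a \<Rightarrow> 'a \<Rightarrow> 'b) \<Rightarrow> bool"
  where "trilinear_on V W \<gamma> \<longleftrightarrow>
    (\<forall>a\<in>V. \<forall>b\<in>V. linear_on V W (\<gamma> a b)) \<and>
    (\<forall>a\<in>V. \<forall>c\<in>V. linear_on V W (\<lambda>b. \<gamma> a b c)) \<and>
    (\<forall>b\<in>V. \<forall>c\<in>V. linear_on V W (\<lambda>a. \<gamma> a b c))"

lemma linear_on_0: "cvec.subspace V \<Longrightarrow> linear_on V W f \<Longrightarrow> f 0 = 0"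
  unfolding linear_on_def by (metis cvec.scale_zero_left cvec.subspace_0)

lemma linear_on_sum:
  assumes V: "cvec.subspace V" and f: "linear_on V W f" and x: "\<And>i. i < n \<Longrightarrow> x i \<in> V"
  shows "f (\<Sum>i<n. x i) = (\<Sum>i<(n::nat). f (x i))"
  using x
proof (induction n)
  case 0
  then show ?case using linear_on_0[OF V f] by simp
next
  case (Suc n)
  have "(\<Sum>i<n. x i) \<in> V" using Suc.prems by (intro cvec.subspace_sum[OF V]) auto
  then show ?case using Suc f by (simp add: linear_on_def)
qed

lemma separating_functional:
  fixes w :: "'d::complex_algebra"
  assumes "\<And>\<phi>::'d \<Rightarrow> complex. linear_on UNIV UNIV \<phi> \<Longrightarrow> \<phi> w = 0"
  shows "w = 0"
proof (rule ccontr)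
  assume w: "w \<noteq> 0"
  interpret vp: vector_space_pair "scaleC :: complex \<Rightarrow> 'd \<Rightarrow> 'd" "scaleC :: complex \<Rightarrow> complex \<Rightarrow> complex" ..
  have "cvec.independent {w}" using w by simp
  then obtain g :: "'d \<Rightarrow> complex" where g: "Vector_Spaces.linear scaleC scaleC g" "\<forall>x\<in>{w}. g x = 1"
    using vp.linear_independent_extend[of "{w}" "\<lambda>_. 1"] by blast
  interpret g: Vector_Spaces.linear scaleC scaleC g by (rule g)
  have "linear_on UNIV UNIV g" by (simp add: linear_on_def g.add g.scale)
  then show False using assms[of g] g(2) by simp
qed

definition subalgebra :: "'a::complex_algebra set \<Rightarrow> bool"
  where "subalgebra B \<longleftrightarrow> cvec.subspace B \<and> (\<forall>x\<in>B. \<forall>y\<in>B. x * y \<in> B)"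

definition nondegenerate :: "'a::complex_algebra set \<Rightarrow> bool"
  where "nondegenerate B \<longleftrightarrow>
    (\<forall>a\<in>B. (\<forall>b\<in>B. a * b = 0) \<longrightarrow> a = 0) \<and> (\<forall>a\<in>B. (\<forall>b\<in>B. b * a = 0) \<longrightarrow> a = 0)"

definition idempotent_algebra :: "'a::complex_algebra set \<Rightarrow> bool"
  where "idempotent_algebra B \<longleftrightarrow> cvec.span {a * b | a b. a \<in> B \<and> b \<in> B} = B"

section \<open>Multipliers\<close>

text \<open>
  A multiplier m of B is the pair of its left action \<open>x \<mapsto> m x\<close> and its right action
  \<open>x \<mapsto> x m\<close>. Both maps are extended by zero outside B, so that equality of multipliers is
  equality of pairs.
\<close>

type_synonym 'a multiplier = "('a \<Rightarrow> 'a) \<times> ('a \<Rightarrow> 'a)"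

abbreviation lact :: "'a multiplier \<Rightarrow> 'a \<Rightarrow> 'a" where "lact \<equiv> fst"
abbreviation ract :: "'a multiplier \<Rightarrow> 'a \<Rightarrow> 'a" where "ract \<equiv> snd"

definition multipliers :: "'a::complex_algebra set \<Rightarrow> 'a multiplier set"
  where "multipliers B = {m. linear_on B B (lact m) \<and> linear_on B B (ract m) \<and>
    (\<forall>x. x \<notin> B \<longrightarrow> lact m x = 0 \<and> ract m x = 0) \<and>
    (\<forall>x\<in>B. \<forall>y\<in>B. x * lact m y = ract m x * y)}"

definition mtimes :: "'a multiplier \<Rightarrow> 'a multiplier \<Rightarrow> 'a multiplier"
  where "mtimes m n = (\<lambda>x. lact m (lact n x), \<lambda>x. ract n (ract m x))"

definition mplus :: "'a::complex_algebra multiplier \<Rightarrow> 'a multiplier \<Rightarrow> 'a multiplier"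
  where "mplus m n = (\<lambda>x. lact m x + lact n x, \<lambda>x. ract m x + ract n x)"

definition mscale :: "complex \<Rightarrow> 'a::complex_algebra multiplier \<Rightarrow> 'a multiplier"
  where "mscale c m = (\<lambda>x. c *\<^sub>C lact m x, \<lambda>x. c *\<^sub>C ract m x)"

definition mone :: "'a::complex_algebra set \<Rightarrow> 'a multiplier"
  where "mone B = (\<lambda>x. if x \<in> B then x else 0, \<lambda>x. if x \<in> B then x else 0)"

text \<open>
  The multiplier of B given by multiplication with y. For y in B this is the embedding of B in
  its multiplier algebra; y may also lie outside B.
\<close>

definition mult_by :: "'a::complex_algebra set \<Rightarrow> 'a \<Rightarrow> 'a multiplier"
  where "mult_by B y = (\<lambda>x. if x \<in> B then y * x else 0, \<lambda>x. if x \<in> B then x * y else 0)"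

definition algebra_hom_to_multipliers ::
    "'a::complex_algebra set \<Rightarrow> 'b::complex_algebra set \<Rightarrow> ('a \<Rightarrow> 'b multiplier) \<Rightarrow> bool"
  where "algebra_hom_to_multipliers A B \<phi> \<longleftrightarrow>
    (\<forall>a\<in>A. \<phi> a \<in> multipliers B) \<and>
    (\<forall>a\<in>A. \<forall>b\<in>A. \<phi> (a + b) = mplus (\<phi> a) (\<phi> b)) \<and>
    (\<forall>c. \<forall>a\<in>A. \<phi> (c *\<^sub>C a) = mscale c (\<phi> a)) \<and>
    (\<forall>a\<in>A. \<forall>b\<in>A. \<phi> (a * b) = mtimes (\<phi> a) (\<phi> b))"

definition multiplier_algebra_hom ::
    "'a::complex_algebra set \<Rightarrow> 'b::complex_algebra set \<Rightarrow> ('a multiplier \<Rightarrow> 'b multiplier) \<Rightarrow> bool"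
  where "multiplier_algebra_hom B C \<Phi> \<longleftrightarrow>
    (\<forall>m\<in>multipliers B. \<Phi> m \<in> multipliers C) \<and>
    (\<forall>m\<in>multipliers B. \<forall>n\<in>multipliers B. \<Phi> (mplus m n) = mplus (\<Phi> m) (\<Phi> n)) \<and>
    (\<forall>c. \<forall>m\<in>multipliers B. \<Phi> (mscale c m) = mscale c (\<Phi> m)) \<and>
    (\<forall>m\<in>multipliers B. \<forall>n\<in>multipliers B. \<Phi> (mtimes m n) = mtimes (\<Phi> m) (\<Phi> n))"

section \<open>Tensor powers\<close>

text \<open>
  \<open>A2\<close> with \<open>tens\<close> and \<open>A3\<close> with \<open>tens3\<close> play the roles of the tensor square and cube of A. They
  are not constructed but characterised (\<open>tensor_powers\<close> below), so that a concrete model can be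
  used in place of the tensor product.
\<close>

locale tensor_data =
  fixes A :: "'a::complex_algebra set"
    and A2 :: "'b::complex_algebra set"
    and tens :: "'a \<Rightarrow> 'a \<Rightarrow> 'b" (infixl "\<otimes>" 70)
    and A3 :: "'c::complex_algebra set"
    and tens3 :: "'a \<Rightarrow> 'a \<Rightarrow> 'a \<Rightarrow> 'c"
begin

text \<open>
  The universal property is required for complex-valued multilinear forms. As linear functionals
  separate the points of a vector space, it follows for arbitrary targets; see
  \<open>lift2_sum\<close> and \<open>lift3_sum\<close>.
\<close>

definition tensor_square :: bool
  where "tensor_square \<longleftrightarrow>
    subalgebra A2 \<and> bilinear_on A A2 tens \<and>
    A2 = cvec.span {a \<otimes> b | a b. a \<in> A \<and> b \<in> A} \<and>
    (\<forall>\<beta>::'a \<Rightarrow> 'a \<Rightarrow> complex. bilinear_on A UNIV \<beta> \<longrightarrow>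
      (\<exists>\<phi>. linear_on A2 UNIV \<phi> \<and> (\<forall>a\<in>A. \<forall>b\<in>A. \<phi> (a \<otimes> b) = \<beta> a b))) \<and>
    (\<forall>a\<in>A. \<forall>b\<in>A. \<forall>c\<in>A. \<forall>d\<in>A. (a \<otimes> b) * (c \<otimes> d) = (a * c) \<otimes> (b * d))"

definition tensor_cube :: bool
  where "tensor_cube \<longleftrightarrow>
    subalgebra A3 \<and> trilinear_on A A3 tens3 \<and>
    A3 = cvec.span {tens3 a b c | a b c. a \<in> A \<and> b \<in> A \<and> c \<in> A} \<and>
    (\<forall>\<gamma>::'a \<Rightarrow> 'a \<Rightarrow> 'a \<Rightarrow> complex. trilinear_on A UNIV \<gamma> \<longrightarrow>
      (\<exists>\<phi>. linear_on A3 UNIV \<phi> \<and> (\<forall>a\<in>A. \<forall>b\<in>A. \<forall>c\<in>A. \<phi> (tens3 a b c) = \<gamma> a b c))) \<and>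
    (\<forall>a\<in>A. \<forall>b\<in>A. \<forall>c\<in>A. \<forall>a'\<in>A. \<forall>b'\<in>A. \<forall>c'\<in>A.
      tens3 a b c * tens3 a' b' c' = tens3 (a * a') (b * b') (c * c'))"

definition tensor_powers :: bool
  where "tensor_powers \<longleftrightarrow> subalgebra A \<and> tensor_square \<and> tensor_cube"

text \<open>
  \<open>lift2 \<beta>\<close> is the linear map on \<open>A2\<close> induced by a bilinear map \<open>\<beta>\<close>: it sends a sum of
  \<open>a i \<otimes> b i\<close> to the sum of \<open>\<beta> (a i) (b i)\<close>, and is zero outside \<open>A2\<close>.
\<close>

definition lift2 :: "('a \<Rightarrow> 'a \<Rightarrow> 'd::complex_algebra) \<Rightarrow> 'b \<Rightarrow> 'd"
  where "lift2 \<beta> x = (if x \<in> A2 then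
      THE w. \<exists>(n::nat) a b. (\<forall>i<n. a i \<in> A \<and> b i \<in> A) \<and>
        x = (\<Sum>i<n. a i \<otimes> b i) \<and> w = (\<Sum>i<n. \<beta> (a i) (b i))
    else 0)"

definition lift3 :: "('a \<Rightarrow> 'a \<Rightarrow> 'a \<Rightarrow> 'd::complex_algebra) \<Rightarrow> 'c \<Rightarrow> 'd"
  where "lift3 \<gamma> x = (if x \<in> A3 then
      THE w. \<exists>(n::nat) a b c. (\<forall>i<n. a i \<in> A \<and> b i \<in> A \<and> c i \<in> A) \<and>
        x = (\<Sum>i<n. tens3 (a i) (b i) (c i)) \<and> w = (\<Sum>i<n. \<gamma> (a i) (b i) (c i))
    else 0)"

lemma lift2_sum:
  assumes sq: "tensor_square" and \<beta>: "bilinear_on A UNIV \<beta>"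
    and ab: "\<And>i. i < n \<Longrightarrow> a i \<in> A \<and> b i \<in> A"
  shows "lift2 \<beta> (\<Sum>i<n. a i \<otimes> b i) = (\<Sum>i<(n::nat). \<beta> (a i) (b i))"
proof -
  have sub: "cvec.subspace A2" and bil: "bilinear_on A A2 tens"
    using sq by (auto simp: tensor_square_def subalgebra_def)
  have mem: "u \<otimes> v \<in> A2" if "u \<in> A" "v \<in> A" for u v
    using bil that by (auto simp: bilinear_on_def linear_on_def)
  have sum_mem: "(\<Sum>i<n. a i \<otimes> b i) \<in> A2"
    using ab mem by (intro cvec.subspace_sum[OF sub]) auto
  have uniq: "(\<Sum>i<n. \<beta> (a i) (b i)) = (\<Sum>i<m. \<beta> (a' i) (b' i))"
    if ab': "\<And>i. i < m \<Longrightarrow> a' i \<in> A \<and> b' i \<in> A"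
      and eq: "(\<Sum>i<n. a i \<otimes> b i) = (\<Sum>i<(m::nat). a' i \<otimes> b' i)" for m a' b'
  proof -
    have "(\<Sum>i<n. \<beta> (a i) (b i)) - (\<Sum>i<m. \<beta> (a' i) (b' i)) = 0"
    proof (rule separating_functional)
      fix \<psi> :: "'d \<Rightarrow> complex" assume \<psi>: "linear_on UNIV UNIV \<psi>"
      have "bilinear_on A UNIV (\<lambda>u v. \<psi> (\<beta> u v))"
        using \<beta> \<psi> by (auto simp: bilinear_on_def linear_on_def)
      then obtain \<phi> where \<phi>: "linear_on A2 UNIV \<phi>"
        and e: "\<And>u v. u \<in> A \<Longrightarrow> v \<in> A \<Longrightarrow> \<phi> (u \<otimes> v) = \<psi> (\<beta> u v)"
        using sq unfolding tensor_square_def by blast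
      have s: "\<psi> (\<Sum>i<k. \<beta> (u i) (v i)) = \<phi> (\<Sum>i<k. u i \<otimes> v i)"
        if "\<And>i. i < k \<Longrightarrow> u i \<in> A \<and> v i \<in> A" for k :: nat and u v
        using that mem by (subst linear_on_sum[OF _ \<psi>], simp, simp)
          (subst linear_on_sum[OF sub \<phi>], auto simp: e)
      have "\<psi> (x - y) = \<psi> x - \<psi> y" for x y
        using \<psi> by (metis UNIV_I diff_add_cancel eq_diff_eq linear_on_def)
      then show "\<psi> ((\<Sum>i<n. \<beta> (a i) (b i)) - (\<Sum>i<m. \<beta> (a' i) (b' i))) = 0"
        using s[of n a b, OF ab] s[of m a' b', OF ab'] eq by simp
    qed
    then show ?thesis by simp
  qed
  show ?thesis
    unfolding lift2_def
  proof (simp only: sum_mem if_True, intro the_equality, goal_cases)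
    case 1
    show ?case
      by (rule exI[of _ n], rule exI[of _ a], rule exI[of _ b]) (simp add: ab)
  next
    case (2 w)
    from 2 obtain m :: nat and a' b' where
      "\<And>i. i < m \<Longrightarrow> a' i \<in> A \<and> b' i \<in> A" "(\<Sum>i<n. a i \<otimes> b i) = (\<Sum>i<m. a' i \<otimes> b' i)" "w = (\<Sum>i<m. \<beta> (a' i) (b' i))"
      by blast
    with uniq[of m a' b'] show ?case by simp
  qed
qed

lemma lift3_sum:
  assumes cu: "tensor_cube" and \<gamma>: "trilinear_on A UNIV \<gamma>"
    and abc: "\<And>i. i < n \<Longrightarrow> a i \<in> A \<and> b i \<in> A \<and> c i \<in> A"
  shows "lift3 \<gamma> (\<Sum>i<n. tens3 (a i) (b i) (c i)) = (\<Sum>i<(n::nat). \<gamma> (a i) (b i) (c i))"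
proof -
  have sub: "cvec.subspace A3" and tri: "trilinear_on A A3 tens3"
    using cu by (auto simp: tensor_cube_def subalgebra_def)
  have mem: "tens3 u v w \<in> A3" if "u \<in> A" "v \<in> A" "w \<in> A" for u v w
    using tri that by (auto simp: trilinear_on_def linear_on_def)
  have sum_mem: "(\<Sum>i<n. tens3 (a i) (b i) (c i)) \<in> A3"
    using abc mem by (intro cvec.subspace_sum[OF sub]) auto
  have uniq: "(\<Sum>i<n. \<gamma> (a i) (b i) (c i)) = (\<Sum>i<m. \<gamma> (a' i) (b' i) (c' i))"
    if abc': "\<And>i. i < m \<Longrightarrow> a' i \<in> A \<and> b' i \<in> A \<and> c' i \<in> A"
      and eq: "(\<Sum>i<n. tens3 (a i) (b i) (c i)) = (\<Sum>i<(m::nat). tens3 (a' i) (b' i) (c' i))"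
    for m a' b' c'
  proof -
    have "(\<Sum>i<n. \<gamma> (a i) (b i) (c i)) - (\<Sum>i<m. \<gamma> (a' i) (b' i) (c' i)) = 0"
    proof (rule separating_functional)
      fix \<psi> :: "'d \<Rightarrow> complex" assume \<psi>: "linear_on UNIV UNIV \<psi>"
      have "trilinear_on A UNIV (\<lambda>u v w. \<psi> (\<gamma> u v w))"
        using \<gamma> \<psi> by (auto simp: trilinear_on_def linear_on_def)
      then obtain \<phi> where \<phi>: "linear_on A3 UNIV \<phi>"
        and e: "\<And>u v w. u \<in> A \<Longrightarrow> v \<in> A \<Longrightarrow> w \<in> A \<Longrightarrow> \<phi> (tens3 u v w) = \<psi> (\<gamma> u v w)"
        using cu unfolding tensor_cube_def by blast
      have s: "\<psi> (\<Sum>i<k. \<gamma> (u i) (v i) (w i)) = \<phi> (\<Sum>i<k. tens3 (u i) (v i) (w i))"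
        if "\<And>i. i < k \<Longrightarrow> u i \<in> A \<and> v i \<in> A \<and> w i \<in> A" for k :: nat and u v w
        using that mem by (subst linear_on_sum[OF _ \<psi>], simp, simp)
          (subst linear_on_sum[OF sub \<phi>], auto simp: e)
      have "\<psi> (x - y) = \<psi> x - \<psi> y" for x y
        using \<psi> by (metis UNIV_I diff_add_cancel eq_diff_eq linear_on_def)
      then show "\<psi> ((\<Sum>i<n. \<gamma> (a i) (b i) (c i)) - (\<Sum>i<m. \<gamma> (a' i) (b' i) (c' i))) = 0"
        using s[of n a b c, OF abc] s[of m a' b' c', OF abc'] eq by simp
    qed
    then show ?thesis by simp
  qed
  show ?thesis
    unfolding lift3_def
  proof (simp only: sum_mem if_True, intro the_equality, goal_cases)
    case 1
    show ?case
      by (rule exI[of _ n], rule exI[of _ a], rule exI[of _ b], rule exI[of _ c]) (simp add: abc)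
  next
    case (2 w)
    from 2 obtain m :: nat and a' b' c' where
      "\<And>i. i < m \<Longrightarrow> a' i \<in> A \<and> b' i \<in> A \<and> c' i \<in> A" "(\<Sum>i<n. tens3 (a i) (b i) (c i)) = (\<Sum>i<m. tens3 (a' i) (b' i) (c' i))" "w = (\<Sum>i<m. \<gamma> (a' i) (b' i) (c' i))"
      by blast
    with uniq[of m a' b' c'] show ?case by simp
  qed
qed

text \<open>\<open>tens_r y c\<close> is \<open>y \<otimes> c\<close> and \<open>tens_l a y\<close> is \<open>a \<otimes> y\<close>, in \<open>A3\<close>, for y in \<open>A2\<close>.\<close>

definition tens_r :: "'b \<Rightarrow> 'a \<Rightarrow> 'c"
  where "tens_r y c = lift2 (\<lambda>u v. tens3 u v c) y"

definition tens_l :: "'a \<Rightarrow> 'b \<Rightarrow> 'c"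
  where "tens_l a y = lift2 (\<lambda>u v. tens3 a u v) y"

text \<open>The multipliers \<open>a \<otimes> 1\<close> and \<open>1 \<otimes> b\<close> of \<open>A2\<close>.\<close>

definition tens_one :: "'a \<Rightarrow> 'b multiplier"
  where "tens_one a = (lift2 (\<lambda>c d. (a * c) \<otimes> d), lift2 (\<lambda>c d. (c * a) \<otimes> d))"

definition one_tens :: "'a \<Rightarrow> 'b multiplier"
  where "one_tens b = (lift2 (\<lambda>c d. c \<otimes> (b * d)), lift2 (\<lambda>c d. c \<otimes> (d * b)))"

text \<open>For a multiplier m of \<open>A2\<close>: the multipliers \<open>m \<otimes> c\<close>, \<open>a \<otimes> m\<close>, \<open>m \<otimes> 1\<close> and \<open>1 \<otimes> m\<close> of \<open>A3\<close>.\<close>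

definition mtens_r :: "'b multiplier \<Rightarrow> 'a \<Rightarrow> 'c multiplier"
  where "mtens_r m c =
    (lift3 (\<lambda>x y z. tens_r (lact m (x \<otimes> y)) (c * z)),
     lift3 (\<lambda>x y z. tens_r (ract m (x \<otimes> y)) (z * c)))"

definition mtens_l :: "'a \<Rightarrow> 'b multiplier \<Rightarrow> 'c multiplier"
  where "mtens_l a m =
    (lift3 (\<lambda>x y z. tens_l (a * x) (lact m (y \<otimes> z))),
     lift3 (\<lambda>x y z. tens_l (x * a) (ract m (y \<otimes> z))))"

definition mtens_one :: "'b multiplier \<Rightarrow> 'c multiplier"
  where "mtens_one m =
    (lift3 (\<lambda>x y z. tens_r (lact m (x \<otimes> y)) z), lift3 (\<lambda>x y z. tens_r (ract m (x \<otimes> y)) z))"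

definition one_mtens :: "'b multiplier \<Rightarrow> 'c multiplier"
  where "one_mtens m =
    (lift3 (\<lambda>x y z. tens_l x (lact m (y \<otimes> z))), lift3 (\<lambda>x y z. tens_l x (ract m (y \<otimes> z))))"

end

section \<open>Weak multiplier Hopf algebras\<close>

locale coproduct_data = tensor_data A A2 tens A3 tens3
  for A :: "'a::complex_algebra set"
    and A2 :: "'b::complex_algebra set"
    and tens :: "'a \<Rightarrow> 'a \<Rightarrow> 'b" (infixl "\<otimes>" 70)
    and A3 :: "'c::complex_algebra set"
    and tens3 :: "'a \<Rightarrow> 'a \<Rightarrow> 'a \<Rightarrow> 'c" +
  fixes \<Delta> :: "'a \<Rightarrow> 'b multiplier"
begin

text \<open>
  The elements \<open>\<Delta>(a)(1 \<otimes> b)\<close> and \<open>(a \<otimes> 1)\<Delta>(b)\<close> of \<open>A2\<close>. The existence of such elements is part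
  of \<open>coproduct\<close>, their uniqueness follows from non-degeneracy.
\<close>

definition Delta1 :: "'a \<Rightarrow> 'a \<Rightarrow> 'b"
  where "Delta1 a b = (THE y. y \<in> A2 \<and> mult_by A2 y = mtimes (\<Delta> a) (one_tens b))"

definition Delta2 :: "'a \<Rightarrow> 'a \<Rightarrow> 'b"
  where "Delta2 a b = (THE y. y \<in> A2 \<and> mult_by A2 y = mtimes (tens_one a) (\<Delta> b))"

definition T1 :: "'b \<Rightarrow> 'b" where "T1 = lift2 Delta1"
definition T2 :: "'b \<Rightarrow> 'b" where "T2 = lift2 Delta2"

text \<open>
  In the coassociativity condition, \<open>(a \<otimes> 1 \<otimes> 1)(\<Delta>(p) \<otimes> q)\<close> is \<open>((a \<otimes> 1)\<Delta>(p)) \<otimes> q\<close> and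
  \<open>(p \<otimes> \<Delta>(q))(1 \<otimes> 1 \<otimes> c)\<close> is \<open>p \<otimes> (\<Delta>(q)(1 \<otimes> c))\<close>.
\<close>

definition coproduct :: bool
  where "coproduct \<longleftrightarrow>
    algebra_hom_to_multipliers A A2 \<Delta> \<and>
    (\<forall>a\<in>A. \<forall>b\<in>A. \<exists>y\<in>A2. mult_by A2 y = mtimes (\<Delta> a) (one_tens b)) \<and>
    (\<forall>a\<in>A. \<forall>b\<in>A. \<exists>y\<in>A2. mult_by A2 y = mtimes (tens_one a) (\<Delta> b)) \<and>
    (\<forall>a\<in>A. \<forall>b\<in>A. \<forall>c\<in>A.
      lift2 (\<lambda>p q. tens_r (Delta2 a p) q) (Delta1 b c) =
      lift2 (\<lambda>p q. tens_l p (Delta1 q c)) (Delta2 a b))"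

definition full_coproduct :: bool
  where "full_coproduct \<longleftrightarrow> coproduct \<and>
    (\<forall>V. cvec.subspace V \<and> V \<subseteq> A \<and>
      (\<forall>a\<in>A. \<forall>b\<in>A. Delta1 a b \<in> cvec.span {v \<otimes> c | v c. v \<in> V \<and> c \<in> A}) \<longrightarrow> V = A) \<and>
    (\<forall>W. cvec.subspace W \<and> W \<subseteq> A \<and>
      (\<forall>a\<in>A. \<forall>b\<in>A. Delta2 a b \<in> cvec.span {c \<otimes> w | c w. c \<in> A \<and> w \<in> W}) \<longrightarrow> W = A)"

definition counit :: "('a \<Rightarrow> complex) \<Rightarrow> bool"
  where "counit \<epsilon> \<longleftrightarrow> linear_on A UNIV \<epsilon> \<and>
    (\<forall>a\<in>A. \<forall>b\<in>A. lift2 (\<lambda>u v. \<epsilon> u *\<^sub>C v) (Delta1 a b) = a * b) \<and>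
    (\<forall>a\<in>A. \<forall>b\<in>A. lift2 (\<lambda>u v. \<epsilon> v *\<^sub>C u) (Delta2 a b) = a * b)"

definition range_idempotent :: "'b multiplier \<Rightarrow> bool"
  where "range_idempotent E \<longleftrightarrow> E \<in> multipliers A2 \<and> mtimes E E = E \<and>
    T1 ` A2 = lact E ` A2 \<and> T2 ` A2 = ract E ` A2"

text \<open>The extensions of \<open>\<Delta> \<otimes> \<iota>\<close> and \<open>\<iota> \<otimes> \<Delta>\<close> to the multiplier algebra of \<open>A2\<close>.\<close>

definition extends_Delta_iota :: "'b multiplier \<Rightarrow> ('b multiplier \<Rightarrow> 'c multiplier) \<Rightarrow> bool"
  where "extends_Delta_iota E \<Phi> \<longleftrightarrow> multiplier_algebra_hom A2 A3 \<Phi> \<and>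
    (\<forall>a\<in>A. \<forall>b\<in>A. \<Phi> (mult_by A2 (a \<otimes> b)) = mtens_r (\<Delta> a) b) \<and>
    \<Phi> (mone A2) = mtens_one E"

definition extends_iota_Delta :: "'b multiplier \<Rightarrow> ('b multiplier \<Rightarrow> 'c multiplier) \<Rightarrow> bool"
  where "extends_iota_Delta E \<Psi> \<longleftrightarrow> multiplier_algebra_hom A2 A3 \<Psi> \<and>
    (\<forall>a\<in>A. \<forall>b\<in>A. \<Psi> (mult_by A2 (a \<otimes> b)) = mtens_l a (\<Delta> b)) \<and>
    \<Psi> (mone A2) = one_mtens E"

definition E_condition :: "'b multiplier \<Rightarrow> bool"
  where "E_condition E \<longleftrightarrow>
    (\<exists>\<Phi> \<Psi>. extends_Delta_iota E \<Phi> \<and> extends_iota_Delta E \<Psi> \<and> \<Psi> E = \<Phi> E \<and>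
      \<Phi> E = mtimes (one_mtens E) (mtens_one E) \<and>
      mtimes (one_mtens E) (mtens_one E) = mtimes (mtens_one E) (one_mtens E))"

text \<open>
  The one-sided multipliers \<open>F1\<close> and \<open>F2\<close> are represented by the maps
  \<open>a \<otimes> b \<mapsto> (a \<otimes> 1) F (1 \<otimes> b)\<close> on \<open>A2\<close>.
\<close>

definition F_multiplier :: "('b \<Rightarrow> 'b) \<Rightarrow> bool"
  where "F_multiplier F \<longleftrightarrow> linear_on A2 A2 F \<and>
    (\<forall>a\<in>A. \<forall>a'\<in>A. \<forall>b\<in>A. \<forall>b'\<in>A.
      F ((a' * a) \<otimes> (b * b')) = ract (one_tens b') (lact (tens_one a') (F (a \<otimes> b))))"

definition F1_condition :: "'b multiplier \<Rightarrow> ('b \<Rightarrow> 'b) \<Rightarrow> bool"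
  where "F1_condition E F1 \<longleftrightarrow> F_multiplier F1 \<and>
    (\<forall>a\<in>A. \<forall>b\<in>A. \<forall>c\<in>A. \<forall>d\<in>A.
      lift2 (\<lambda>p q. tens_r (F1 (p \<otimes> b)) (q * d)) (ract E (a \<otimes> c)) =
      lift2 (\<lambda>p q. tens_l p (lact (one_tens q) (lact E (b \<otimes> d)))) (ract E (a \<otimes> c)))"

definition F2_condition :: "'b multiplier \<Rightarrow> ('b \<Rightarrow> 'b) \<Rightarrow> bool"
  where "F2_condition E F2 \<longleftrightarrow> F_multiplier F2 \<and>
    (\<forall>a\<in>A. \<forall>b\<in>A. \<forall>c\<in>A. \<forall>d\<in>A.
      lift2 (\<lambda>p q. tens_l (d * p) (F2 (b \<otimes> q))) (lact E (a \<otimes> c)) =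
      lift2 (\<lambda>p q. tens_r (ract (tens_one p) (ract E (d \<otimes> b))) q) (lact E (a \<otimes> c)))"

definition kernel_conditions :: "('b \<Rightarrow> 'b) \<Rightarrow> ('b \<Rightarrow> 'b) \<Rightarrow> bool"
  where "kernel_conditions F1 F2 \<longleftrightarrow>
    {x \<in> A2. T1 x = 0} = cvec.span {a \<otimes> b - F1 (a \<otimes> b) | a b. a \<in> A \<and> b \<in> A} \<and>
    {x \<in> A2. T2 x = 0} = cvec.span {a \<otimes> b - F2 (a \<otimes> b) | a b. a \<in> A \<and> b \<in> A}"

definition structure_elements :: "'b multiplier \<Rightarrow> ('b \<Rightarrow> 'b) \<Rightarrow> ('b \<Rightarrow> 'b) \<Rightarrow> bool"
  where "structure_elements E F1 F2 \<longleftrightarrow> range_idempotent E \<and> E_condition E \<and>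
    F1_condition E F1 \<and> F2_condition E F2 \<and> kernel_conditions F1 F2"

definition weak_multiplier_Hopf_algebra :: bool
  where "weak_multiplier_Hopf_algebra \<longleftrightarrow>
    tensor_powers \<and> nondegenerate A \<and> idempotent_algebra A \<and> full_coproduct \<and>
    (\<exists>\<epsilon>. counit \<epsilon>) \<and> (\<exists>E F1 F2. structure_elements E F1 F2)"

definition is_R1 :: "'b multiplier \<Rightarrow> ('b \<Rightarrow> 'b) \<Rightarrow> ('b \<Rightarrow> 'b) \<Rightarrow> bool"
  where "is_R1 E F1 R \<longleftrightarrow> linear_on A2 A2 R \<and>
    (\<forall>x\<in>A2. T1 (R (T1 x)) = T1 x) \<and> (\<forall>x\<in>A2. R (T1 (R x)) = R x) \<and>
    (\<forall>a\<in>A. \<forall>b\<in>A. T1 (R (a \<otimes> b)) = lact E (a \<otimes> b)) \<and>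
    (\<forall>a\<in>A. \<forall>b\<in>A. R (T1 (a \<otimes> b)) = F1 (a \<otimes> b))"

text \<open>
  \<open>antipode a\<close> is the left multiplier S(a), as a map on A. The description is definite because
  \<open>\<epsilon>\<close>, \<open>E\<close>, \<open>F1\<close>, \<open>F2\<close> and \<open>R\<close> (the last three as maps on \<open>A2\<close>) are unique.
\<close>

definition antipode :: "'a \<Rightarrow> 'a \<Rightarrow> 'a"
  where "antipode a b = (THE w. \<exists>\<epsilon> E F1 F2 R.
    counit \<epsilon> \<and> structure_elements E F1 F2 \<and> is_R1 E F1 R \<and>
    w = lift2 (\<lambda>u v. \<epsilon> u *\<^sub>C v) (R (a \<otimes> b)))"

end

section \<open>Groupoids and their function algebras\<close>

text \<open>\<open>pr p q\<close> is the product of p and q; it is meaningful only if \<open>src p = tgt q\<close>.\<close>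

locale groupoid =
  fixes G :: "'g set"
    and pr :: "'g \<Rightarrow> 'g \<Rightarrow> 'g" (infixl "\<cdot>" 70)
    and src tgt inv :: "'g \<Rightarrow> 'g"
  assumes src_closed: "p \<in> G \<Longrightarrow> src p \<in> G"
    and tgt_closed: "p \<in> G \<Longrightarrow> tgt p \<in> G"
    and src_tgt_units: "p \<in> G \<Longrightarrow> src (src p) = src p" "p \<in> G \<Longrightarrow> tgt (src p) = src p"
      "p \<in> G \<Longrightarrow> src (tgt p) = tgt p" "p \<in> G \<Longrightarrow> tgt (tgt p) = tgt p"
    and pr_closed: "\<lbrakk>p \<in> G; q \<in> G; src p = tgt q\<rbrakk> \<Longrightarrow> p \<cdot> q \<in> G"
    and src_pr: "\<lbrakk>p \<in> G; q \<in> G; src p = tgt q\<rbrakk> \<Longrightarrow> src (p \<cdot> q) = src q"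
    and tgt_pr: "\<lbrakk>p \<in> G; q \<in> G; src p = tgt q\<rbrakk> \<Longrightarrow> tgt (p \<cdot> q) = tgt p"
    and pr_assoc: "\<lbrakk>p \<in> G; q \<in> G; r \<in> G; src p = tgt q; src q = tgt r\<rbrakk>
      \<Longrightarrow> (p \<cdot> q) \<cdot> r = p \<cdot> (q \<cdot> r)"
    and pr_src: "p \<in> G \<Longrightarrow> p \<cdot> src p = p"
    and tgt_pr_left: "p \<in> G \<Longrightarrow> tgt p \<cdot> p = p"
    and inv_closed: "p \<in> G \<Longrightarrow> inv p \<in> G"
    and src_inv: "p \<in> G \<Longrightarrow> src (inv p) = tgt p"
    and tgt_inv: "p \<in> G \<Longrightarrow> tgt (inv p) = src p"
    and inv_pr: "p \<in> G \<Longrightarrow> inv p \<cdot> p = src p"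
    and pr_inv: "p \<in> G \<Longrightarrow> p \<cdot> inv p = tgt p"

text \<open>
  K(X): a function on X is represented by its extension by zero to the whole type. The algebra
  operations on functions are the pointwise ones.
\<close>

definition fin_supp_fun :: "'x set \<Rightarrow> ('x \<Rightarrow> complex) set"
  where "fin_supp_fun X = {f. finite {x. f x \<noteq> 0} \<and> {x. f x \<noteq> 0} \<subseteq> X}"

definition fun_tens :: "('g \<Rightarrow> complex) \<Rightarrow> ('g \<Rightarrow> complex) \<Rightarrow> 'g \<times> 'g \<Rightarrow> complex"
  where "fun_tens f g = (\<lambda>(p, q). f p * g q)"

definition fun_tens3 ::
    "('g \<Rightarrow> complex) \<Rightarrow> ('g \<Rightarrow> complex) \<Rightarrow> ('g \<Rightarrow> complex) \<Rightarrow> 'g \<times> 'g \<times> 'g \<Rightarrow> complex"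
  where "fun_tens3 f g h = (\<lambda>(p, q, r). f p * g q * h r)"

text \<open>
  A complex function on \<open>G \<times> G\<close> acts on \<open>K(G \<times> G)\<close> as a multiplier by pointwise
  multiplication.
\<close>

definition groupoid_coproduct ::
    "'g set \<Rightarrow> ('g \<Rightarrow> 'g \<Rightarrow> 'g) \<Rightarrow> ('g \<Rightarrow> 'g) \<Rightarrow> ('g \<Rightarrow> 'g) \<Rightarrow>
     ('g \<Rightarrow> complex) \<Rightarrow> ('g \<times> 'g \<Rightarrow> complex) multiplier"
  where "groupoid_coproduct G pr src tgt f = mult_by (fin_supp_fun (G \<times> G))
    (\<lambda>(p, q). if p \<in> G \<and> q \<in> G \<and> src p = tgt q then f (pr p q) else 0)"

end

theory Submission
  imports Defs
begin

text \<open>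
  The functions with finite support on \<open>X\<close> are spanned by the indicators of points, and their
  multipliers are all functions on \<open>X\<close>; so every map in sight is a pullback or a pointwise
  product. \<open>T\<^sub>1\<close> is the pullback along the bijection \<open>(p, q) \<mapsto> (pq, q)\<close> from the pairs with
  \<open>s(p) = t(q)\<close> to the pairs with \<open>s(p) = s(q)\<close>, and \<open>R\<^sub>1\<close> the pullback along its inverse
  \<open>(p, q) \<mapsto> (pq\<^sup>-\<^sup>1, q)\<close>. Hence \<open>E\<close> and \<open>F\<^sub>1\<close> are the indicators of these two sets; likewise \<open>F\<^sub>2\<close>
  is the indicator of \<open>t(p) = t(q)\<close>. The counit sums the values at the units, so only the pair
  \<open>(s(q), q)\<close> contributes to \<open>(S(f)g)(q)\<close>, with \<open>f(s(q)q\<^sup>-\<^sup>1)g(q)\<close>. As the antipode is defined by a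
  description, the uniqueness of \<open>\<epsilon>\<close>, \<open>E\<close>, \<open>F\<^sub>1\<close> and \<open>R\<^sub>1\<close> is needed too; it is read off from their
  values at points.
\<close>

section \<open>Functions with finite support\<close>

lemma fun_alg_simps: "(c *\<^sub>C f) x = c *\<^sub>C f x" "c *\<^sub>C z = c * z" for z :: complex
  by (simp_all add: scaleC_fun_def scaleC_complex_def)

definition point :: "'x \<Rightarrow> 'x \<Rightarrow> complex"
  where "point x = (\<lambda>t. if t = x then 1 else 0)"

lemma point_in [simp]: "x \<in> X \<Longrightarrow> point x \<in> fin_supp_fun X"
  by (auto simp: fin_supp_fun_def point_def)

lemma fin_supp_fun_zero: "f \<in> fin_supp_fun X \<Longrightarrow> x \<notin> X \<Longrightarrow> f x = 0"
  by (auto simp: fin_supp_fun_def)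

lemma fin_supp_fun_subset:
  assumes "f \<in> fin_supp_fun X" and "\<And>t. g t \<noteq> 0 \<Longrightarrow> f t \<noteq> 0"
  shows "g \<in> fin_supp_fun X"
  using assms unfolding fin_supp_fun_def by (auto intro: finite_subset[of _ "{t. f t \<noteq> 0}"])

text \<open>\<open>h\<close> embeds the support of \<open>y\<close> into the finite support of
  \<open>x\<close>. Injectivity is asked only on \<open>S\<close>, because a groupoid map such as
  (p, q) -> (pq, q) is controlled only where the product is defined.\<close>

lemma fin_supp_fun_pullback:
  assumes x: "x \<in> fin_supp_fun X" and inj: "inj_on h S"
    and y: "\<And>t. y t \<noteq> 0 \<Longrightarrow> t \<in> S \<and> t \<in> Y \<and> x (h t) \<noteq> 0"
  shows "y \<in> fin_supp_fun Y"
proof -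
  have "h ` {t. y t \<noteq> 0} \<subseteq> {s. x s \<noteq> 0}"
    using y by auto
  then have "finite (h ` {t. y t \<noteq> 0})"
    using x by (auto simp: fin_supp_fun_def intro: finite_subset)
  moreover have "inj_on h {t. y t \<noteq> 0}"
    using inj y by (meson inj_on_subset mem_Collect_eq subsetI)
  ultimately have "finite {t. y t \<noteq> 0}"
    by (rule finite_imageD)
  then show ?thesis using y by (auto simp: fin_supp_fun_def)
qed

lemma fin_supp_fun_mult [simp]:
  assumes "f \<in> fin_supp_fun X"
  shows "y * f \<in> fin_supp_fun X" "f * y \<in> fin_supp_fun X"
  by (rule fin_supp_fun_subset[OF assms]; simp)+

lemma subspace_fin_supp_fun: "cvec.subspace (fin_supp_fun X)"
proof (rule cvec.subspaceI)
  fix f g assume fg: "f \<in> fin_supp_fun X" "g \<in> fin_supp_fun X"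
  have "{x. (f + g) x \<noteq> 0} \<subseteq> {x. f x \<noteq> 0} \<union> {x. g x \<noteq> 0}" by auto
  then show "f + g \<in> fin_supp_fun X"
    using fg unfolding fin_supp_fun_def by (auto intro: finite_subset)
next
  fix c f assume "f \<in> fin_supp_fun X"
  then show "c *\<^sub>C f \<in> fin_supp_fun X"
    by (rule fin_supp_fun_subset) (simp add: fun_alg_simps)
qed (simp add: fin_supp_fun_def)

lemmas fin_supp_fun_add [simp] = cvec.subspace_add[OF subspace_fin_supp_fun]
lemmas fin_supp_fun_diff [simp] = cvec.subspace_diff[OF subspace_fin_supp_fun]
lemmas fin_supp_fun_scale [simp] = cvec.subspace_scale[OF subspace_fin_supp_fun]
lemmas fin_supp_fun_0 [simp] = cvec.subspace_0[OF subspace_fin_supp_fun]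

lemma subalgebra_fin_supp_fun: "subalgebra (fin_supp_fun X)"
  by (simp add: subalgebra_def subspace_fin_supp_fun)

text \<open>Splitting off the value at one point of the support leaves a function with strictly
  smaller support, so the induction runs over the finite support.\<close>

lemma fin_supp_fun_induct [consumes 1, case_names zero add]:
  assumes f: "f \<in> fin_supp_fun X" and zero: "P 0"
    and add: "\<And>c x f. x \<in> X \<Longrightarrow> f \<in> fin_supp_fun X \<Longrightarrow> P f \<Longrightarrow> P (c *\<^sub>C point x + f)"
  shows "P f"
proof -
  have fin: "finite {x. f x \<noteq> 0}" using f by (simp add: fin_supp_fun_def)
  then show ?thesis using f
  proof (induction "{x. f x \<noteq> 0}" arbitrary: f rule: finite_psubset_induct)
    case (psubset f)
    show ?case
    proof (cases "f = 0")
      case False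
      then obtain x where x: "f x \<noteq> 0" by (auto simp: fun_eq_iff)
      define g where "g = f(x := 0)"
      have g: "g \<in> fin_supp_fun X"
        using psubset.prems by (rule fin_supp_fun_subset) (auto simp: g_def split: if_splits)
      have "P g"
        by (rule psubset.hyps) (use x g in \<open>auto simp: g_def\<close>)
      moreover have "x \<in> X"
        using x psubset.prems fin_supp_fun_zero by metis
      moreover have "f = f x *\<^sub>C point x + g"
        by (auto simp: fun_eq_iff g_def point_def fun_alg_simps)
      ultimately show ?thesis using add[of x g "f x"] g by simp
    qed (use zero in simp)
  qed
qed

lemma fin_supp_fun_eq_span: "fin_supp_fun X = cvec.span (point ` X)"
proof
  show "fin_supp_fun X \<subseteq> cvec.span (point ` X)"
  proof
    fix f assume "f \<in> fin_supp_fun X"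
    then show "f \<in> cvec.span (point ` X)"
      by (rule fin_supp_fun_induct[where P = "\<lambda>f. f \<in> cvec.span (point ` X)"])
        (auto intro: cvec.span_add cvec.span_scale cvec.span_base cvec.span_zero)
  qed
  show "cvec.span (point ` X) \<subseteq> fin_supp_fun X"
    by (rule cvec.span_minimal) (auto simp: subspace_fin_supp_fun)
qed

lemma linear_on_fin_supp_fun_eqI:
  assumes L: "linear_on (fin_supp_fun X) W L" "linear_on (fin_supp_fun X) W' L'"
    and eq: "\<And>x. x \<in> X \<Longrightarrow> L (point x) = L' (point x)" and f: "f \<in> fin_supp_fun X"
  shows "L f = L' f"
  using f
proof (rule fin_supp_fun_induct)
  show "L 0 = L' 0" using linear_on_0[OF subspace_fin_supp_fun] L by metis
  show "L (c *\<^sub>C point x + f) = L' (c *\<^sub>C point x + f)"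
    if "x \<in> X" "f \<in> fin_supp_fun X" "L f = L' f" for c x f
    using L eq that by (simp add: linear_on_def)
qed

lemma linear_extension:
  fixes h :: "'x \<Rightarrow> complex"
  obtains \<phi> where "linear_on (fin_supp_fun X) UNIV \<phi>" "\<And>x. x \<in> X \<Longrightarrow> \<phi> (point x) = h x"
proof
  let ?\<phi> = "\<lambda>f. \<Sum>x | f x \<noteq> 0. f x * h x"
  \<comment> \<open>The range of summation depends on \<open>f\<close>. Passing to a common finite
    superset of the supports makes sums for different functions comparable.\<close>
  have *: "?\<phi> f = (\<Sum>x\<in>S. f x * h x)" if "finite S" "{x. f x \<noteq> 0} \<subseteq> S" for S and f
    using that by (intro sum.mono_neutral_left) auto
  have add: "?\<phi> (f + g) = ?\<phi> f + ?\<phi> g" if "f \<in> fin_supp_fun X" "g \<in> fin_supp_fun X" for f g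
  proof -
    let ?S = "{x. f x \<noteq> 0} \<union> {x. g x \<noteq> 0}"
    have fin: "finite ?S" using that by (auto simp: fin_supp_fun_def)
    show ?thesis
      unfolding *[OF fin, of f, simplified] *[OF fin, of g, simplified]
      by (subst *[OF fin]) (auto simp: algebra_simps sum.distrib)
  qed
  \<comment> \<open>A nonzero scalar leaves the support unchanged. For an infinite support both sums
    have the default value 0, so finiteness is not assumed here.\<close>
  have scale: "?\<phi> (c *\<^sub>C f) = c *\<^sub>C ?\<phi> f" for c and f :: "'x \<Rightarrow> complex"
    by (cases "c = 0") (auto simp: fun_alg_simps sum_distrib_left mult.assoc)
  show "linear_on (fin_supp_fun X) UNIV ?\<phi>"
    using add scale by (simp add: linear_on_def)
  show "?\<phi> (point x) = h x" for x
  proof -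
    have "{t. point x t \<noteq> 0} = {x}" by (auto simp: point_def)
    then show ?thesis by (simp add: point_def)
  qed
qed

lemma nondegenerate_fin_supp_fun: "nondegenerate (fin_supp_fun X)"
proof -
  have "a = 0" if a: "a \<in> fin_supp_fun X" "\<And>x. x \<in> X \<Longrightarrow> a * point x = 0" for a
  proof
    fix x
    have "(a * point x) x = 0" if "x \<in> X" using a(2)[OF that] by simp
    then show "a x = 0 x" using fin_supp_fun_zero[OF a(1)] by (cases "x \<in> X") (auto simp: point_def)
  qed
  then show ?thesis
    unfolding nondegenerate_def by (metis point_in mult.commute)
qed

lemma idempotent_fin_supp_fun: "idempotent_algebra (fin_supp_fun X)"
  unfolding idempotent_algebra_def
proof (rule antisym)
  show "cvec.span {a * b | a b. a \<in> fin_supp_fun X \<and> b \<in> fin_supp_fun X} \<subseteq> fin_supp_fun X"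
    by (rule cvec.span_minimal) (auto simp: subspace_fin_supp_fun)
  show "fin_supp_fun X \<subseteq> cvec.span {a * b | a b. a \<in> fin_supp_fun X \<and> b \<in> fin_supp_fun X}"
  proof (subst fin_supp_fun_eq_span, rule cvec.span_mono, rule subsetI)
    fix a assume "a \<in> point ` X"
    \<comment> \<open>An indicator is its own square, so each spanning function is already a
      product.\<close>
    then have "a = a * a \<and> a \<in> fin_supp_fun X \<and> a \<in> fin_supp_fun X"
      by (auto simp: fun_eq_iff point_def) (auto simp flip: point_def)
    then show "a \<in> {a * b | a b. a \<in> fin_supp_fun X \<and> b \<in> fin_supp_fun X}"
      by (intro CollectI exI)
  qed
qed

section \<open>Multipliers are functions\<close>

lemma mult_by_simps [simp]:
  "x \<in> fin_supp_fun X \<Longrightarrow> lact (mult_by (fin_supp_fun X) y) x = y * x"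
  "x \<in> fin_supp_fun X \<Longrightarrow> ract (mult_by (fin_supp_fun X) y) x = y * x"
  by (auto simp: mult_by_def fun_eq_iff)

text \<open>The pointwise product is commutative, so the left and right actions of a function
  coincide. The conditions outside the algebra reflect the convention that actions are extended by
  zero.\<close>

lemma multiplier_eqI:
  assumes "\<And>x. x \<in> fin_supp_fun X \<Longrightarrow> lact m x = y * x" "\<And>x. x \<in> fin_supp_fun X \<Longrightarrow> ract m x = y * x"
    "\<And>x. x \<notin> fin_supp_fun X \<Longrightarrow> lact m x = 0" "\<And>x. x \<notin> fin_supp_fun X \<Longrightarrow> ract m x = 0"
  shows "m = mult_by (fin_supp_fun X) y"
  using assms by (auto simp: mult_by_def prod_eq_iff fun_eq_iff mult.commute)

lemma mult_by_in_multipliers: "mult_by (fin_supp_fun X) y \<in> multipliers (fin_supp_fun X)"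
  unfolding multipliers_def linear_on_def
  by (auto simp: mult_by_def ring_distribs mult_scaleC_left mult_scaleC_right mult.assoc)

lemma mult_by_cong:
  assumes "\<And>x. x \<in> X \<Longrightarrow> y x = z x"
  shows "mult_by (fin_supp_fun X) y = mult_by (fin_supp_fun X) z"
  by (rule multiplier_eqI)
    (auto simp: fun_eq_iff mult_by_def dest: fin_supp_fun_zero intro: assms)

text \<open>A multiplier of K(X) sends each \<open>point x\<close> with x in X to a multiple of
  itself. The factor is the value at x of the function that represents the multiplier.\<close>

definition coeff :: "('x \<Rightarrow> complex) multiplier \<Rightarrow> 'x \<Rightarrow> complex"
  where "coeff m x = lact m (point x) x"

lemma coeff_mult_by [simp]: "x \<in> X \<Longrightarrow> coeff (mult_by (fin_supp_fun X) y) x = y x"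
  by (simp add: coeff_def) (simp add: point_def)

lemma mult_by_eq_iff:
  "mult_by (fin_supp_fun X) y = mult_by (fin_supp_fun X) z \<longleftrightarrow> (\<forall>x\<in>X. y x = z x)"
  by (metis coeff_mult_by mult_by_cong)

text \<open>Compatibility of the two actions on \<open>point t\<close> and \<open>point x\<close>
  with t different from x, evaluated at t, shows that the image of \<open>point x\<close> vanishes
  off x. Hence the left action is diagonal on the basis of points, and the same compatibility then
  forces the right action.\<close>

lemma multiplier_eq_mult_by:
  assumes m: "m \<in> multipliers (fin_supp_fun X)"
  shows "m = mult_by (fin_supp_fun X) (coeff m)"
proof -
  have lin: "linear_on (fin_supp_fun X) (fin_supp_fun X) (lact m)"
    and rin: "\<And>f. f \<in> fin_supp_fun X \<Longrightarrow> ract m f \<in> fin_supp_fun X"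
    and sw: "\<And>f g. f \<in> fin_supp_fun X \<Longrightarrow> g \<in> fin_supp_fun X \<Longrightarrow> f * lact m g = ract m f * g"
    using m by (auto simp: multipliers_def linear_on_def)
  have lp: "lact m (point x) = coeff m * point x" if x: "x \<in> X" for x
  proof
    fix t
    show "lact m (point x) t = (coeff m * point x) t"
    proof (cases "t = x")
      case True
      then show ?thesis by (simp add: coeff_def point_def)
    next
      case False
      have "lact m (point x) t = 0"
      proof (cases "t \<in> X")
        case True
        have "(point t * lact m (point x)) t = (ract m (point t) * point x) t"
          using sw True x by simp
        then show ?thesis using False by (simp add: point_def)
      next
        case False
        then show ?thesis
          using lin x by (auto simp: linear_on_def intro: fin_supp_fun_zero)
      qed
      then show ?thesis using False by (simp add: point_def)
    qed
  qed
  have l: "lact m f = coeff m * f" if "f \<in> fin_supp_fun X" for f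
  proof (rule linear_on_fin_supp_fun_eqI[OF lin _ lp that])
    show "linear_on (fin_supp_fun X) UNIV ((*) (coeff m))"
      by (auto simp: linear_on_def fun_eq_iff fun_alg_simps algebra_simps)
  qed
  have r: "ract m f = coeff m * f" if f: "f \<in> fin_supp_fun X" for f
  proof
    fix t
    show "ract m f t = (coeff m * f) t"
    proof (cases "t \<in> X")
      case True
      have "(f * lact m (point t)) t = (ract m f * point t) t"
        using sw f True by simp
      then show ?thesis by (simp add: lp[OF True]) (simp add: point_def mult.commute)
    next
      case False
      then show ?thesis using rin[OF f] f by (simp add: fin_supp_fun_zero)
    qed
  qed
  show ?thesis
    by (rule multiplier_eqI) (use l r m in \<open>auto simp: multipliers_def\<close>)
qed

lemma mtimes_mult_by [simp]:
  "mtimes (mult_by (fin_supp_fun X) y) (mult_by (fin_supp_fun X) z) = mult_by (fin_supp_fun X) (y * z)"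
  by (rule multiplier_eqI) (simp_all add: mtimes_def mult.assoc mult.left_commute, simp_all add: mult_by_def)

lemma mplus_mult_by [simp]:
  "mplus (mult_by (fin_supp_fun X) y) (mult_by (fin_supp_fun X) z) = mult_by (fin_supp_fun X) (y + z)"
  by (rule multiplier_eqI) (simp_all add: mplus_def distrib_right, simp_all add: mult_by_def)

lemma mscale_mult_by [simp]:
  "mscale c (mult_by (fin_supp_fun X) y) = mult_by (fin_supp_fun X) (c *\<^sub>C y)"
  by (rule multiplier_eqI) (simp_all add: mscale_def mult_scaleC_left, simp_all add: mult_by_def)

lemma mone_eq_mult_by: "mone (fin_supp_fun X) = mult_by (fin_supp_fun X) 1"
  by (rule multiplier_eqI) (simp_all add: mone_def)

lemma coeff_simps:
  "coeff (mplus m n) t = coeff m t + coeff n t"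
  "coeff (mscale c m) t = c * coeff m t"
  by (simp_all add: coeff_def mplus_def mscale_def fun_alg_simps)

lemma coeff_mtimes:
  assumes "m \<in> multipliers (fin_supp_fun X)" "n \<in> multipliers (fin_supp_fun X)" "t \<in> X"
  shows "coeff (mtimes m n) t = coeff m t * coeff n t"
  by (subst multiplier_eq_mult_by[OF assms(1)], subst multiplier_eq_mult_by[OF assms(2)])
    (simp add: assms)

section \<open>Tensor powers of the function algebra\<close>

text \<open>
  By uniqueness of the induced map, \<open>lift2\<close> and \<open>lift3\<close> are computed by exhibiting any linear map
  with the right values on elementary tensors.
\<close>

lemma (in tensor_data) lift2_eq:
  assumes sq: tensor_square and L: "linear_on A2 UNIV L"
    and eq: "\<And>a b. a \<in> A \<Longrightarrow> b \<in> A \<Longrightarrow> \<beta> a b = L (a \<otimes> b)"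
    and A: "cvec.subspace A"
  shows "lift2 \<beta> = (\<lambda>x. if x \<in> A2 then L x else 0)"
proof
  fix x
  have sub: "cvec.subspace A2" and bil: "bilinear_on A A2 (\<otimes>)"
    and span: "A2 = cvec.span {a \<otimes> b | a b. a \<in> A \<and> b \<in> A}"
    using sq by (auto simp: tensor_square_def subalgebra_def)
  have mem: "a \<otimes> b \<in> A2" if "a \<in> A" "b \<in> A" for a b
    using bil that by (auto simp: bilinear_on_def linear_on_def)
  have "bilinear_on A UNIV \<beta>"
    using bil L eq mem A
    by (simp add: bilinear_on_def linear_on_def cvec.subspace_add cvec.subspace_scale)
  note lift2_sum = lift2_sum[OF sq this]
  have repr: "\<exists>(n::nat) a b. (\<forall>i<n. a i \<in> A \<and> b i \<in> A) \<and> x = (\<Sum>i<n. a i \<otimes> b i)" if "x \<in> A2"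
    using that[unfolded span]
  proof (induction rule: cvec.span_induct_alt)
    case base
    show ?case by (rule exI[of _ 0]) simp
  next
    case (step c t y)
    then obtain u v n a b where uv: "t = u \<otimes> v" "u \<in> A" "v \<in> A"
      and ab: "\<And>i. i < (n::nat) \<Longrightarrow> a i \<in> A \<and> b i \<in> A" "y = (\<Sum>i<n. a i \<otimes> b i)" by blast
    \<comment> \<open>\<open>lift2_sum\<close> speaks of sums without coefficients, so the scalar is
      absorbed into the first factor of the new summand.\<close>
    let ?a = "a(n := c *\<^sub>C u)" and ?b = "b(n := v)"
    have "c *\<^sub>C t + y = (\<Sum>i<Suc n. ?a i \<otimes> ?b i)"
      using bil uv ab by (simp add: bilinear_on_def linear_on_def add.commute)
    moreover have "\<forall>i<Suc n. ?a i \<in> A \<and> ?b i \<in> A"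
      using uv ab A by (auto simp: cvec.subspace_scale less_Suc_eq)
    ultimately show ?case by blast
  qed
  show "lift2 \<beta> x = (if x \<in> A2 then L x else 0)"
  proof (cases "x \<in> A2")
    case True
    then obtain n a b where ab: "\<And>i. i < (n::nat) \<Longrightarrow> a i \<in> A \<and> b i \<in> A"
      and x: "x = (\<Sum>i<n. a i \<otimes> b i)"
      using repr by blast
    have "lift2 \<beta> x = (\<Sum>i<n. L (a i \<otimes> b i))"
      unfolding x by (subst lift2_sum) (use ab eq in auto)
    also have "\<dots> = L x"
      unfolding x by (subst linear_on_sum[OF sub L]) (use ab mem in auto)
    finally show ?thesis using True by simp
  qed (simp add: lift2_def)
qed

lemma (in tensor_data) lift3_eq:
  assumes cu: tensor_cube and L: "linear_on A3 UNIV L"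
    and eq: "\<And>a b c. a \<in> A \<Longrightarrow> b \<in> A \<Longrightarrow> c \<in> A \<Longrightarrow> \<gamma> a b c = L (tens3 a b c)"
    and A: "cvec.subspace A"
  shows "lift3 \<gamma> = (\<lambda>x. if x \<in> A3 then L x else 0)"
proof
  fix x
  have sub: "cvec.subspace A3" and tri: "trilinear_on A A3 tens3"
    and span: "A3 = cvec.span {tens3 a b c | a b c. a \<in> A \<and> b \<in> A \<and> c \<in> A}"
    using cu by (auto simp: tensor_cube_def subalgebra_def)
  have mem: "tens3 a b c \<in> A3" if "a \<in> A" "b \<in> A" "c \<in> A" for a b c
    using tri that by (auto simp: trilinear_on_def linear_on_def)
  have "trilinear_on A UNIV \<gamma>"
    using tri L eq mem A
    by (simp add: trilinear_on_def linear_on_def cvec.subspace_add cvec.subspace_scale)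
  note lift3_sum = lift3_sum[OF cu this]
  have repr: "\<exists>(n::nat) a b c. (\<forall>i<n. a i \<in> A \<and> b i \<in> A \<and> c i \<in> A) \<and> x = (\<Sum>i<n. tens3 (a i) (b i) (c i))"
    if "x \<in> A3"
    using that[unfolded span]
  proof (induction rule: cvec.span_induct_alt)
    case base
    show ?case by (rule exI[of _ 0]) simp
  next
    case (step k t y)
    then obtain u v w n a b c where uv: "t = tens3 u v w" "u \<in> A" "v \<in> A" "w \<in> A"
      and ab: "\<And>i. i < (n::nat) \<Longrightarrow> a i \<in> A \<and> b i \<in> A \<and> c i \<in> A" "y = (\<Sum>i<n. tens3 (a i) (b i) (c i))"
      by blast
    let ?a = "a(n := k *\<^sub>C u)" and ?b = "b(n := v)" and ?c = "c(n := w)"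
    have "k *\<^sub>C t + y = (\<Sum>i<Suc n. tens3 (?a i) (?b i) (?c i))"
      using tri uv ab by (simp add: trilinear_on_def linear_on_def add.commute)
    moreover have "\<forall>i<Suc n. ?a i \<in> A \<and> ?b i \<in> A \<and> ?c i \<in> A"
      using uv ab A by (auto simp: cvec.subspace_scale less_Suc_eq)
    ultimately show ?case by blast
  qed
  show "lift3 \<gamma> x = (if x \<in> A3 then L x else 0)"
  proof (cases "x \<in> A3")
    case True
    then obtain n a b c where abc: "\<And>i. i < (n::nat) \<Longrightarrow> a i \<in> A \<and> b i \<in> A \<and> c i \<in> A"
      and x: "x = (\<Sum>i<n. tens3 (a i) (b i) (c i))"
      using repr by blast
    have "lift3 \<gamma> x = (\<Sum>i<n. L (tens3 (a i) (b i) (c i)))"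
      unfolding x by (subst lift3_sum) (use abc eq in auto)
    also have "\<dots> = L x"
      unfolding x by (subst linear_on_sum[OF sub L]) (use abc mem in auto)
    finally show ?thesis using True by simp
  qed (simp add: lift3_def)
qed

lemma fun_tens_apply [simp]: "fun_tens f g (p, q) = f p * g q"
  by (simp add: fun_tens_def)

lemma fun_tens3_apply [simp]: "fun_tens3 f g h (p, q, r) = f p * g q * h r"
  by (simp add: fun_tens3_def)

lemma fun_tens_point [simp]: "fun_tens (point p) (point q) = point (p, q)"
  by (auto simp: fun_eq_iff point_def)

lemma fun_tens3_point [simp]: "fun_tens3 (point p) (point q) (point r) = point (p, q, r)"
  by (auto simp: fun_eq_iff point_def)

lemma fun_tens_in [simp]:
  assumes "f \<in> fin_supp_fun X" "g \<in> fin_supp_fun Y"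
  shows "fun_tens f g \<in> fin_supp_fun (X \<times> Y)"
proof -
  have "{x. fun_tens f g x \<noteq> 0} = {x. f x \<noteq> 0} \<times> {x. g x \<noteq> 0}" by auto
  then show ?thesis using assms by (auto simp: fin_supp_fun_def)
qed

lemma fun_tens3_in [simp]:
  assumes "f \<in> fin_supp_fun X" "g \<in> fin_supp_fun Y" "h \<in> fin_supp_fun Z"
  shows "fun_tens3 f g h \<in> fin_supp_fun (X \<times> Y \<times> Z)"
proof -
  have "{x. fun_tens3 f g h x \<noteq> 0} = {x. f x \<noteq> 0} \<times> {x. g x \<noteq> 0} \<times> {x. h x \<noteq> 0}" by auto
  then show ?thesis using assms by (auto simp: fin_supp_fun_def)
qed

section \<open>Function algebras on G x G and G x G x G as tensor powers\<close>

locale function_tensors =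
  fixes G :: "'g set"
begin

abbreviation "A \<equiv> fin_supp_fun G"
abbreviation "A2 \<equiv> fin_supp_fun (G \<times> G)"
abbreviation "A3 \<equiv> fin_supp_fun (G \<times> G \<times> G)"

sublocale tensor_data A A2 fun_tens A3 fun_tens3 .

lemma bilinear_fun_tens: "bilinear_on A A2 fun_tens"
  by (auto simp: bilinear_on_def linear_on_def fun_eq_iff fun_alg_simps algebra_simps)

lemma trilinear_fun_tens3: "trilinear_on A A3 fun_tens3"
  by (auto simp: trilinear_on_def linear_on_def fun_eq_iff fun_alg_simps algebra_simps)

text \<open>The basis element \<open>point (p, q)\<close> is the tensor of \<open>point p\<close>
  and \<open>point q\<close>, so a bilinear form prescribes the values of a linear form on a basis.
  Agreement on all elementary tensors then follows by linearity in one variable at a time.\<close>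

lemma tensor_square: "tensor_square"
proof -
  have "A2 \<subseteq> cvec.span {fun_tens a b | a b. a \<in> A \<and> b \<in> A}"
    unfolding fin_supp_fun_eq_span[of "G \<times> G"]
  proof (rule cvec.span_mono, rule subsetI)
    fix x assume "x \<in> point ` (G \<times> G)"
    then obtain p q where "p \<in> G" "q \<in> G" "x = point (p, q)" by blast
    then have "x = fun_tens (point p) (point q) \<and> point p \<in> A \<and> point q \<in> A" by simp
    then show "x \<in> {fun_tens a b | a b. a \<in> A \<and> b \<in> A}"
      by (intro CollectI exI)
  qed
  moreover have "cvec.span {fun_tens a b | a b. a \<in> A \<and> b \<in> A} \<subseteq> A2"
    by (intro cvec.span_minimal subspace_fin_supp_fun) auto
  moreover have "\<exists>\<phi>. linear_on A2 UNIV \<phi> \<and> (\<forall>a\<in>A. \<forall>b\<in>A. \<phi> (fun_tens a b) = \<beta> a b)"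
    if \<beta>: "bilinear_on A UNIV \<beta>" for \<beta> :: "_ \<Rightarrow> _ \<Rightarrow> complex"
  proof -
    obtain \<phi> where \<phi>: "linear_on A2 UNIV \<phi>" "\<And>x. x \<in> G \<times> G \<Longrightarrow> \<phi> (point x) = \<beta> (point (fst x)) (point (snd x))"
      using linear_extension[of "G \<times> G" "\<lambda>x. \<beta> (point (fst x)) (point (snd x))"] by blast
    have b: "bilinear_on A UNIV (\<lambda>a b. \<phi> (fun_tens a b))"
      using \<phi>(1) bilinear_fun_tens by (auto simp: bilinear_on_def linear_on_def)
    have 1: "\<phi> (fun_tens (point p) b) = \<beta> (point p) b" if "p \<in> G" "b \<in> A" for p b
      by (rule linear_on_fin_supp_fun_eqI[of G UNIV _ UNIV])
        (use b \<beta> that \<phi>(2) in \<open>auto simp: bilinear_on_def\<close>)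
    have "\<phi> (fun_tens a b) = \<beta> a b" if "a \<in> A" "b \<in> A" for a b
      by (rule linear_on_fin_supp_fun_eqI[of G UNIV "\<lambda>a. \<phi> (fun_tens a b)" UNIV "\<lambda>a. \<beta> a b"])
        (use b \<beta> that 1 in \<open>auto simp: bilinear_on_def\<close>)
    then show ?thesis using \<phi>(1) by blast
  qed
  moreover have "fun_tens a b * fun_tens c d = fun_tens (a * c) (b * d)"
    for a b c d :: "'g \<Rightarrow> complex"
    by (auto simp: fun_eq_iff)
  ultimately show ?thesis
    unfolding tensor_square_def
    by (intro conjI subalgebra_fin_supp_fun bilinear_fun_tens subset_antisym) simp_all
qed

lemma tensor_cube: "tensor_cube"
proof -
  have "A3 \<subseteq> cvec.span {fun_tens3 a b c | a b c. a \<in> A \<and> b \<in> A \<and> c \<in> A}"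
    unfolding fin_supp_fun_eq_span[of "G \<times> G \<times> G"]
  proof (rule cvec.span_mono, rule subsetI)
    fix x assume "x \<in> point ` (G \<times> G \<times> G)"
    then obtain p q r where "p \<in> G" "q \<in> G" "r \<in> G" "x = point (p, q, r)" by blast
    then have "x = fun_tens3 (point p) (point q) (point r) \<and> point p \<in> A \<and> point q \<in> A \<and> point r \<in> A"
      by simp
    then show "x \<in> {fun_tens3 a b c | a b c. a \<in> A \<and> b \<in> A \<and> c \<in> A}"
      by (intro CollectI exI)
  qed
  moreover have "cvec.span {fun_tens3 a b c | a b c. a \<in> A \<and> b \<in> A \<and> c \<in> A} \<subseteq> A3"
    by (intro cvec.span_minimal subspace_fin_supp_fun) auto
  moreover have "\<exists>\<phi>. linear_on A3 UNIV \<phi> \<and> (\<forall>a\<in>A. \<forall>b\<in>A. \<forall>c\<in>A. \<phi> (fun_tens3 a b c) = \<gamma> a b c)"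
    if \<gamma>: "trilinear_on A UNIV \<gamma>" for \<gamma> :: "_ \<Rightarrow> _ \<Rightarrow> _ \<Rightarrow> complex"
  proof -
    obtain \<phi> where \<phi>: "linear_on A3 UNIV \<phi>"
      "\<And>x. x \<in> G \<times> G \<times> G \<Longrightarrow> \<phi> (point x) = \<gamma> (point (fst x)) (point (fst (snd x))) (point (snd (snd x)))"
      using linear_extension[of "G \<times> G \<times> G"
          "\<lambda>x. \<gamma> (point (fst x)) (point (fst (snd x))) (point (snd (snd x)))"] by blast
    have b: "trilinear_on A UNIV (\<lambda>a b c. \<phi> (fun_tens3 a b c))"
      using \<phi>(1) trilinear_fun_tens3 by (auto simp: trilinear_on_def linear_on_def)
    have 1: "\<phi> (fun_tens3 (point p) (point q) c) = \<gamma> (point p) (point q) c" if "p \<in> G" "q \<in> G" "c \<in> A" for p q c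
      by (rule linear_on_fin_supp_fun_eqI[of G UNIV _ UNIV])
        (use b \<gamma> that \<phi>(2) in \<open>auto simp: trilinear_on_def\<close>)
    have 2: "\<phi> (fun_tens3 (point p) b c) = \<gamma> (point p) b c" if "p \<in> G" "b \<in> A" "c \<in> A" for p b c
      by (rule linear_on_fin_supp_fun_eqI[of G UNIV
            "\<lambda>b. \<phi> (fun_tens3 (point p) b c)" UNIV "\<lambda>b. \<gamma> (point p) b c"])
        (use b \<gamma> that 1 in \<open>auto simp: trilinear_on_def\<close>)
    have "\<phi> (fun_tens3 a b c) = \<gamma> a b c" if "a \<in> A" "b \<in> A" "c \<in> A" for a b c
      by (rule linear_on_fin_supp_fun_eqI[of G UNIV
            "\<lambda>a. \<phi> (fun_tens3 a b c)" UNIV "\<lambda>a. \<gamma> a b c"])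
        (use b \<gamma> that 2 in \<open>auto simp: trilinear_on_def\<close>)
    then show ?thesis using \<phi>(1) by blast
  qed
  moreover have "fun_tens3 a b c * fun_tens3 a' b' c' = fun_tens3 (a * a') (b * b') (c * c')"
    for a b c a' b' c' :: "'g \<Rightarrow> complex"
    by (auto simp: fun_eq_iff)
  ultimately show ?thesis
    unfolding tensor_cube_def
    by (intro conjI subalgebra_fin_supp_fun trilinear_fun_tens3 subset_antisym) simp_all
qed

lemma tensor_powers: "tensor_powers"
  by (simp add: tensor_powers_def subalgebra_fin_supp_fun tensor_square tensor_cube)

lemmas lift2_fun = lift2_eq[OF tensor_square _ _ subspace_fin_supp_fun]
lemmas lift3_fun = lift3_eq[OF tensor_cube _ _ subspace_fin_supp_fun]

lemma tens_r_eq [simp]: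
  assumes "y \<in> A2" "c \<in> A"
  shows "tens_r y c = (\<lambda>(p, q, r). y (p, q) * c r)"
  unfolding tens_r_def
  by (subst lift2_fun[where L = "\<lambda>y. \<lambda>(p, q, r). y (p, q) * c r"])
    (use assms in \<open>auto simp: linear_on_def fun_eq_iff fun_alg_simps algebra_simps\<close>)

lemma tens_l_eq [simp]:
  assumes "y \<in> A2" "a \<in> A"
  shows "tens_l a y = (\<lambda>(p, q, r). a p * y (q, r))"
  unfolding tens_l_def
  by (subst lift2_fun[where L = "\<lambda>y. \<lambda>(p, q, r). a p * y (q, r)"])
    (use assms in \<open>auto simp: linear_on_def fun_eq_iff fun_alg_simps algebra_simps\<close>)

text \<open>Multiplication by a fixed \<open>y\<close> is linear, hence it is the map induced by its
  own values on elementary tensors. Multipliers defined through \<open>lift2\<close> thereby become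
  functions of two variables.\<close>

lemma lift2_mult_by:
  assumes "\<And>a b. a \<in> A \<Longrightarrow> b \<in> A \<Longrightarrow> \<beta> a b = y * fun_tens a b"
  shows "lift2 \<beta> = (\<lambda>x. if x \<in> A2 then y * x else 0)"
  by (rule lift2_fun) (use assms in \<open>auto simp: linear_on_def ring_distribs mult_scaleC_right\<close>)

lemma lift3_mult_by:
  assumes "\<And>a b c. a \<in> A \<Longrightarrow> b \<in> A \<Longrightarrow> c \<in> A \<Longrightarrow> \<gamma> a b c = y * fun_tens3 a b c"
  shows "lift3 \<gamma> = (\<lambda>x. if x \<in> A3 then y * x else 0)"
  by (rule lift3_fun) (use assms in \<open>auto simp: linear_on_def ring_distribs mult_scaleC_right\<close>)

lemma tens_one_eq [simp]: "tens_one a = mult_by A2 (\<lambda>(p, q). a p)"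
  unfolding tens_one_def
  by (subst (1 2) lift2_mult_by[where y = "\<lambda>(p, q). a p"])
    (auto simp: fun_eq_iff mult_by_def)

lemma one_tens_eq [simp]: "one_tens b = mult_by A2 (\<lambda>(p, q). b q)"
  unfolding one_tens_def
  by (subst (1 2) lift2_mult_by[where y = "\<lambda>(p, q). b q"])
    (auto simp: fun_eq_iff mult_by_def)

lemma mtens_one_eq [simp]: "mtens_one (mult_by A2 y) = mult_by A3 (\<lambda>(p, q, r). y (p, q))"
  unfolding mtens_one_def
  by (subst (1 2) lift3_mult_by[where y = "\<lambda>(p, q, r). y (p, q)"])
    (auto simp: fun_eq_iff mult_by_def)

lemma one_mtens_eq [simp]: "one_mtens (mult_by A2 y) = mult_by A3 (\<lambda>(p, q, r). y (q, r))"
  unfolding one_mtens_def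
  by (subst (1 2) lift3_mult_by[where y = "\<lambda>(p, q, r). y (q, r)"])
    (auto simp: fun_eq_iff mult_by_def)

lemma mtens_r_eq [simp]: "c \<in> A \<Longrightarrow> mtens_r (mult_by A2 y) c = mult_by A3 (\<lambda>(p, q, r). y (p, q) * c r)"
  unfolding mtens_r_def
  by (subst (1 2) lift3_mult_by[where y = "\<lambda>(p, q, r). y (p, q) * c r"])
    (auto simp: fun_eq_iff mult_by_def)

lemma mtens_l_eq [simp]: "a \<in> A \<Longrightarrow> mtens_l a (mult_by A2 y) = mult_by A3 (\<lambda>(p, q, r). a p * y (q, r))"
  unfolding mtens_l_def
  by (subst (1 2) lift3_mult_by[where y = "\<lambda>(p, q, r). a p * y (q, r)"])
    (auto simp: fun_eq_iff mult_by_def)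

end

section \<open>The coproduct of a groupoid\<close>

context groupoid
begin

sublocale function_tensors G .
sublocale coproduct_data A A2 fun_tens A3 fun_tens3 "groupoid_coproduct G pr src tgt" .

abbreviation \<Delta> where "\<Delta> \<equiv> groupoid_coproduct G pr src tgt"

lemmas structure_simps [simp] =
  src_closed tgt_closed src_tgt_units pr_closed src_pr tgt_pr pr_src tgt_pr_left
  inv_closed src_inv tgt_inv inv_pr pr_inv

section \<open>Cancellation in the groupoid\<close>

lemma pr_inv_cancel [simp]: "\<lbrakk>p \<in> G; q \<in> G; src p = tgt q\<rbrakk> \<Longrightarrow> pr (pr p q) (inv q) = p"
  by (metis inv_closed pr_assoc pr_inv pr_src tgt_inv)

lemma inv_pr_cancel [simp]: "\<lbrakk>p \<in> G; q \<in> G; src p = src q\<rbrakk> \<Longrightarrow> pr (pr p (inv q)) q = p"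
  by (metis inv_closed inv_pr pr_assoc pr_src src_inv tgt_inv)

lemma pr_cancel_inv [simp]: "\<lbrakk>p \<in> G; q \<in> G; tgt p = tgt q\<rbrakk> \<Longrightarrow> pr p (pr (inv p) q) = q"
  by (metis inv_closed pr_assoc pr_inv src_inv tgt_inv tgt_pr_left)

lemma inv_cancel_pr [simp]: "\<lbrakk>p \<in> G; q \<in> G; src p = tgt q\<rbrakk> \<Longrightarrow> pr (inv p) (pr p q) = q"
  by (metis inv_closed inv_pr pr_assoc src_inv tgt_pr_left)

text \<open>\<open>comp_ind\<close>, \<open>src_ind\<close> and \<open>tgt_ind\<close> are the functions giving \<open>E\<close>, \<open>F\<^sub>1\<close> and \<open>F\<^sub>2\<close>.\<close>

definition comp_ind :: "'g \<times> 'g \<Rightarrow> complex"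
  where "comp_ind = (\<lambda>(p, q). if p \<in> G \<and> q \<in> G \<and> src p = tgt q then 1 else 0)"

definition src_ind :: "'g \<times> 'g \<Rightarrow> complex"
  where "src_ind = (\<lambda>(p, q). if p \<in> G \<and> q \<in> G \<and> src p = src q then 1 else 0)"

definition tgt_ind :: "'g \<times> 'g \<Rightarrow> complex"
  where "tgt_ind = (\<lambda>(p, q). if p \<in> G \<and> q \<in> G \<and> tgt p = tgt q then 1 else 0)"

section \<open>The canonical maps and their generalised inverses as pullbacks\<close>

definition t1 :: "('g \<times> 'g \<Rightarrow> complex) \<Rightarrow> 'g \<times> 'g \<Rightarrow> complex"
  where "t1 x = (\<lambda>(p, q). comp_ind (p, q) * x (pr p q, q))"

definition t2 :: "('g \<times> 'g \<Rightarrow> complex) \<Rightarrow> 'g \<times> 'g \<Rightarrow> complex"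
  where "t2 x = (\<lambda>(p, q). comp_ind (p, q) * x (p, pr p q))"

definition r1 :: "('g \<times> 'g \<Rightarrow> complex) \<Rightarrow> 'g \<times> 'g \<Rightarrow> complex"
  where "r1 x = (\<lambda>(p, q). src_ind (p, q) * x (pr p (inv q), q))"

text \<open>Pullback along (p, q) -> (p, p^-1 q), the inverse of the bijection behind
  \<open>t2\<close>. It serves to compute the range and the kernel of \<open>T2\<close>.\<close>

definition r2 :: "('g \<times> 'g \<Rightarrow> complex) \<Rightarrow> 'g \<times> 'g \<Rightarrow> complex"
  where "r2 x = (\<lambda>(p, q). tgt_ind (p, q) * x (p, pr (inv p) q))"

lemma t_apply:
  "t1 x (p, q) = comp_ind (p, q) * x (pr p q, q)"
  "t2 x (p, q) = comp_ind (p, q) * x (p, pr p q)"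
  "r1 x (p, q) = src_ind (p, q) * x (pr p (inv q), q)"
  "r2 x (p, q) = tgt_ind (p, q) * x (p, pr (inv p) q)"
  by (simp_all add: t1_def t2_def r1_def r2_def)

lemma t1_in [simp]: assumes "x \<in> A2" shows "t1 x \<in> A2"
proof (rule fin_supp_fun_pullback[OF assms])
  show "inj_on (\<lambda>(p, q). (pr p q, q)) {(p, q). p \<in> G \<and> q \<in> G \<and> src p = tgt q}"
    by (rule inj_on_inverseI[of _ "\<lambda>(p, q). (pr p (inv q), q)"]) auto
qed (auto simp: t_apply comp_ind_def split: if_splits)

lemma t2_in [simp]: assumes "x \<in> A2" shows "t2 x \<in> A2"
proof (rule fin_supp_fun_pullback[OF assms])
  show "inj_on (\<lambda>(p, q). (p, pr p q)) {(p, q). p \<in> G \<and> q \<in> G \<and> src p = tgt q}"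
    by (rule inj_on_inverseI[of _ "\<lambda>(p, q). (p, pr (inv p) q)"]) auto
qed (auto simp: t_apply comp_ind_def split: if_splits)

lemma r1_in [simp]: assumes "x \<in> A2" shows "r1 x \<in> A2"
proof (rule fin_supp_fun_pullback[OF assms])
  show "inj_on (\<lambda>(p, q). (pr p (inv q), q)) {(p, q). p \<in> G \<and> q \<in> G \<and> src p = src q}"
    by (rule inj_on_inverseI[of _ "\<lambda>(p, q). (pr p q, q)"]) auto
qed (auto simp: t_apply src_ind_def split: if_splits)

lemma r2_in [simp]: assumes "x \<in> A2" shows "r2 x \<in> A2"
proof (rule fin_supp_fun_pullback[OF assms])
  show "inj_on (\<lambda>(p, q). (p, pr (inv p) q)) {(p, q). p \<in> G \<and> q \<in> G \<and> tgt p = tgt q}"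
    by (rule inj_on_inverseI[of _ "\<lambda>(p, q). (p, pr p q)"]) auto
qed (auto simp: t_apply tgt_ind_def split: if_splits)

lemma linear_t1: "linear_on A2 A2 t1" and linear_t2: "linear_on A2 A2 t2"
  and linear_r1: "linear_on A2 A2 r1"
  unfolding linear_on_def
  by (auto simp: t_apply fun_eq_iff fun_alg_simps algebra_simps)

text \<open>The maps (p, q) -> (pq, q) and (p, q) -> (p, pq) carry the composable pairs bijectively
  onto the pairs with equal sources and onto those with equal targets. Pulling back along a
  bijection and then along its inverse leaves only the indicator of the set on which one
  started.\<close>

lemma t1_r1: "t1 (r1 x) = comp_ind * x"
  and r1_t1: "r1 (t1 x) = src_ind * x"
  and t2_r2: "t2 (r2 x) = comp_ind * x"
  and r2_t2: "r2 (t2 x) = tgt_ind * x"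
  and comp_ind_t1: "comp_ind * t1 x = t1 x"
  and comp_ind_t2: "comp_ind * t2 x = t2 x"
  and t1_src_ind: "t1 (src_ind * x) = t1 x"
  and t2_tgt_ind: "t2 (tgt_ind * x) = t2 x"
  and src_ind_r1: "src_ind * r1 x = r1 x"
  and r1_comp_ind: "r1 (comp_ind * x) = r1 x"
  by (auto simp: fun_eq_iff t_apply comp_ind_def src_ind_def tgt_ind_def)

lemma Delta_eq: "\<Delta> f = mult_by A2 (\<lambda>(p, q). comp_ind (p, q) * f (pr p q))"
  unfolding groupoid_coproduct_def by (rule mult_by_cong) (auto simp: comp_ind_def)

text \<open>Elements of \<open>A2\<close> vanish off G x G, and on G x G the multiplier determines
  the values. This makes the descriptions of \<open>Delta1\<close> and \<open>Delta2\<close>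
  definite.\<close>

lemma mult_by_A2_inj:
  assumes "x \<in> A2" "y \<in> A2" "mult_by A2 x = mult_by A2 y"
  shows "x = y"
proof
  fix t show "x t = y t"
    using assms by (metis mult_by_eq_iff fin_supp_fun_zero)
qed

lemma Delta1_mult: "mult_by A2 (t1 (fun_tens a b)) = mtimes (\<Delta> a) (one_tens b)"
  unfolding Delta_eq by (simp, rule mult_by_cong) (auto simp: t_apply)

lemma Delta2_mult: "mult_by A2 (t2 (fun_tens a b)) = mtimes (tens_one a) (\<Delta> b)"
  unfolding Delta_eq by (simp, rule mult_by_cong) (auto simp: t_apply)

lemma Delta1_eq [simp]: "a \<in> A \<Longrightarrow> b \<in> A \<Longrightarrow> Delta1 a b = t1 (fun_tens a b)"
  unfolding Delta1_def
  by (rule the_equality) (auto simp: Delta1_mult simp del: one_tens_eq intro: mult_by_A2_inj)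

lemma Delta2_eq [simp]: "a \<in> A \<Longrightarrow> b \<in> A \<Longrightarrow> Delta2 a b = t2 (fun_tens a b)"
  unfolding Delta2_def
  by (rule the_equality) (auto simp: Delta2_mult simp del: tens_one_eq intro: mult_by_A2_inj)

lemma T1_eq [simp]: "x \<in> A2 \<Longrightarrow> T1 x = t1 x"
  unfolding T1_def by (subst lift2_fun[where L = t1]) (use linear_t1 in \<open>auto simp: linear_on_def\<close>)

lemma T2_eq [simp]: "x \<in> A2 \<Longrightarrow> T2 x = t2 x"
  unfolding T2_def by (subst lift2_fun[where L = t2]) (use linear_t2 in \<open>auto simp: linear_on_def\<close>)

lemma Delta_hom: "algebra_hom_to_multipliers A A2 \<Delta>"
  unfolding algebra_hom_to_multipliers_def Delta_eq
  by (auto simp: mult_by_in_multipliers mult_by_eq_iff fun_alg_simps algebra_simps comp_ind_def)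

text \<open>At (u, v, w) both sides are a(u) b(uvw) c(w) if uv and vw are defined, and 0 otherwise;
  associativity identifies the two readings of uvw.\<close>

lemma coassociative:
  assumes abc: "a \<in> A" "b \<in> A" "c \<in> A"
  shows "lift2 (\<lambda>p q. tens_r (Delta2 a p) q) (Delta1 b c) =
    lift2 (\<lambda>p q. tens_l p (Delta1 q c)) (Delta2 a b)"
proof -
  have "lift2 (\<lambda>p q. tens_r (Delta2 a p) q) =
      (\<lambda>x. if x \<in> A2 then \<lambda>(u, v, w). a u * comp_ind (u, v) * x (pr u v, w) else 0)"
    by (rule lift2_fun)
      (use abc in \<open>auto simp: t_apply linear_on_def fun_eq_iff fun_alg_simps algebra_simps\<close>)
  moreover have "lift2 (\<lambda>p q. tens_l p (Delta1 q c)) =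
      (\<lambda>x. if x \<in> A2 then \<lambda>(u, v, w). c w * comp_ind (v, w) * x (u, pr v w) else 0)"
    by (rule lift2_fun)
      (use abc in \<open>auto simp: t_apply linear_on_def fun_eq_iff fun_alg_simps algebra_simps\<close>)
  ultimately show ?thesis
    using abc by (auto simp: t_apply fun_eq_iff comp_ind_def pr_assoc)
qed

lemma coproduct: "coproduct"
  unfolding coproduct_def using Delta_hom coassociative
  by (blast intro: Delta1_mult Delta2_mult t1_in t2_in fun_tens_in)

section \<open>Slices and fullness of the coproduct\<close>

lemma slice_in [simp]:
  assumes "x \<in> A2"
  shows "(\<lambda>p. x (p, q)) \<in> A" "(\<lambda>p. x (q, p)) \<in> A"
proof -
  have "x (p, q) \<noteq> 0 \<Longrightarrow> p \<in> G" "x (q, p) \<noteq> 0 \<Longrightarrow> p \<in> G" for p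
    using assms fin_supp_fun_zero by (metis mem_Sigma_iff)+
  then show "(\<lambda>p. x (p, q)) \<in> A" "(\<lambda>p. x (q, p)) \<in> A"
    using fin_supp_fun_pullback[OF assms, of "\<lambda>p. (p, q)" UNIV "\<lambda>p. x (p, q)" G]
      fin_supp_fun_pullback[OF assms, of "\<lambda>p. (q, p)" UNIV "\<lambda>p. x (q, p)" G]
    by (auto simp: inj_on_def)
qed

text \<open>As s(p) is a unit, the only composable pair (u, v) with (uv, v) = (p, s(p)) is (p, s(p))
  itself. This fixed point isolates the single value at p, both for fullness and for the uniqueness
  of the counit.\<close>

lemma t1_point: "p \<in> G \<Longrightarrow> t1 (point (p, src p)) = point (p, src p)"
  by (auto simp: fun_eq_iff t_apply comp_ind_def point_def split: if_splits; metis pr_src)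

lemma t2_point: "p \<in> G \<Longrightarrow> t2 (point (tgt p, p)) = point (tgt p, p)"
  by (auto simp: fun_eq_iff t_apply comp_ind_def point_def)

lemma point_slice:
  "(\<lambda>p. point (a, b) (p, b)) = point a" "(\<lambda>p. point (b, a) (b, p)) = point a"
  by (auto simp: point_def)

text \<open>Fixing the second variable sends the tensor product of \<open>V\<close> and
  \<open>A\<close> into \<open>V\<close>. Applied to the fixed point of \<open>t1\<close> at (p,
  s(p)), this puts every \<open>point p\<close> into \<open>V\<close>. The other leg is treated in
  the same way with the fixed point of \<open>t2\<close> at (t(p), p).\<close>

lemma full_coproduct: "full_coproduct"
  unfolding full_coproduct_def
proof (intro conjI allI impI coproduct)
  fix V
  assume V: "cvec.subspace V \<and> V \<subseteq> A \<and>
    (\<forall>a\<in>A. \<forall>b\<in>A. Delta1 a b \<in> cvec.span {fun_tens v c | v c. v \<in> V \<and> c \<in> A})"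
  have slice: "(\<lambda>p. x (p, q)) \<in> V" if "x \<in> cvec.span {fun_tens v c | v c. v \<in> V \<and> c \<in> A}" for x q
    using that
  proof (rule cvec.span_induct)
    show "cvec.subspace {x. (\<lambda>p. x (p, q)) \<in> V}"
    proof (rule cvec.subspaceI)
      fix x y assume "x \<in> {x. (\<lambda>p. x (p, q)) \<in> V}" "y \<in> {x. (\<lambda>p. x (p, q)) \<in> V}"
      then show "x + y \<in> {x. (\<lambda>p. x (p, q)) \<in> V}"
        using V cvec.subspace_add[of V "\<lambda>p. x (p, q)" "\<lambda>p. y (p, q)"] by (simp add: plus_fun_def)
    next
      fix k x assume "x \<in> {x. (\<lambda>p. x (p, q)) \<in> V}"
      then show "k *\<^sub>C x \<in> {x. (\<lambda>p. x (p, q)) \<in> V}"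
        using V cvec.subspace_scale[of V "\<lambda>p. x (p, q)" k] by (simp add: scaleC_fun_def)
    qed (use V cvec.subspace_0[of V] in \<open>simp add: zero_fun_def\<close>)
  next
    fix x assume "x \<in> {fun_tens v c | v c. v \<in> V \<and> c \<in> A}"
    then obtain v c where x: "x = fun_tens v c" "v \<in> V" by blast
    have "(\<lambda>p. x (p, q)) = c q *\<^sub>C v" using x by (simp add: fun_eq_iff fun_alg_simps)
    then show "(\<lambda>p. x (p, q)) \<in> V" using V x by (simp add: cvec.subspace_scale)
  qed
  have "point p \<in> V" if p: "p \<in> G" for p
  proof -
    have "Delta1 (point p) (point (src p)) \<in> cvec.span {fun_tens v c | v c. v \<in> V \<and> c \<in> A}"
      using V p by (simp del: Delta1_eq)
    from slice[OF this, of "src p"] show ?thesis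
      using p by (simp add: t1_point point_slice)
  qed
  then show "V = A"
    using V fin_supp_fun_eq_span[of G] cvec.span_minimal[of "point ` G" V] by auto
next
  fix V
  assume V: "cvec.subspace V \<and> V \<subseteq> A \<and>
    (\<forall>a\<in>A. \<forall>b\<in>A. Delta2 a b \<in> cvec.span {fun_tens c v | c v. c \<in> A \<and> v \<in> V})"
  have slice: "(\<lambda>p. x (q, p)) \<in> V" if "x \<in> cvec.span {fun_tens c v | c v. c \<in> A \<and> v \<in> V}" for x q
    using that
  proof (rule cvec.span_induct)
    show "cvec.subspace {x. (\<lambda>p. x (q, p)) \<in> V}"
    proof (rule cvec.subspaceI)
      fix x y assume "x \<in> {x. (\<lambda>p. x (q, p)) \<in> V}" "y \<in> {x. (\<lambda>p. x (q, p)) \<in> V}"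
      then show "x + y \<in> {x. (\<lambda>p. x (q, p)) \<in> V}"
        using V cvec.subspace_add[of V "\<lambda>p. x (q, p)" "\<lambda>p. y (q, p)"] by (simp add: plus_fun_def)
    next
      fix k x assume "x \<in> {x. (\<lambda>p. x (q, p)) \<in> V}"
      then show "k *\<^sub>C x \<in> {x. (\<lambda>p. x (q, p)) \<in> V}"
        using V cvec.subspace_scale[of V "\<lambda>p. x (q, p)" k] by (simp add: scaleC_fun_def)
    qed (use V cvec.subspace_0[of V] in \<open>simp add: zero_fun_def\<close>)
  next
    fix x assume "x \<in> {fun_tens c v | c v. c \<in> A \<and> v \<in> V}"
    then obtain v c where x: "x = fun_tens c v" "v \<in> V" by blast
    have "(\<lambda>p. x (q, p)) = c q *\<^sub>C v" using x by (simp add: fun_eq_iff fun_alg_simps)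
    then show "(\<lambda>p. x (q, p)) \<in> V" using V x by (simp add: cvec.subspace_scale)
  qed
  have "point p \<in> V" if p: "p \<in> G" for p
  proof -
    have "Delta2 (point (tgt p)) (point p) \<in> cvec.span {fun_tens c v | c v. c \<in> A \<and> v \<in> V}"
      using V p by (simp del: Delta2_eq)
    from slice[OF this, of "tgt p"] show ?thesis
      using p by (simp add: t2_point point_slice)
  qed
  then show "V = A"
    using V fin_supp_fun_eq_span[of G] cvec.span_minimal[of "point ` G" V] by auto
qed

section \<open>The counit\<close>

text \<open>A slice of an elementary tensor is a multiple of one factor, the multiple being a value
  of the other factor. Hence applying \<epsilon> to one leg amounts to applying it to every
  slice.\<close>

lemma lift2_slice:
  assumes \<epsilon>: "linear_on A UNIV \<epsilon>" and x: "x \<in> A2"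
  shows "lift2 (\<lambda>u v. \<epsilon> u *\<^sub>C v) x = (\<lambda>q. \<epsilon> (\<lambda>p. x (p, q)))"
    and "lift2 (\<lambda>u v. \<epsilon> v *\<^sub>C u) x = (\<lambda>q. \<epsilon> (\<lambda>p. x (q, p)))"
proof -
  \<comment> \<open>\<open>h\<close> stands for either order of the two variables, so both kinds of
    slices are treated at once.\<close>
  have lin: "linear_on A2 UNIV (\<lambda>x q. \<epsilon> (\<lambda>p. x (h q p)))"
    if h: "\<And>x q. x \<in> A2 \<Longrightarrow> (\<lambda>p. x (h q p)) \<in> A" for h :: "'g \<Rightarrow> 'g \<Rightarrow> 'g \<times> 'g"
    unfolding linear_on_def
  proof (intro conjI ballI allI ext UNIV_I)
    fix x y q assume "x \<in> A2" "y \<in> A2"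
    moreover have "(\<lambda>p. (x + y) (h q p)) = (\<lambda>p. x (h q p)) + (\<lambda>p. y (h q p))"
      by (simp add: fun_eq_iff)
    ultimately show "\<epsilon> (\<lambda>p. (x + y) (h q p)) = ((\<lambda>q. \<epsilon> (\<lambda>p. x (h q p))) + (\<lambda>q. \<epsilon> (\<lambda>p. y (h q p)))) q"
      using \<epsilon> h unfolding linear_on_def plus_fun_apply by metis
  next
    fix k x q assume "x \<in> A2"
    moreover have "(\<lambda>p. (k *\<^sub>C x) (h q p)) = k *\<^sub>C (\<lambda>p. x (h q p))"
      by (simp add: scaleC_fun_def)
    ultimately show "\<epsilon> (\<lambda>p. (k *\<^sub>C x) (h q p)) = (k *\<^sub>C (\<lambda>q. \<epsilon> (\<lambda>p. x (h q p)))) q"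
      using \<epsilon> h unfolding linear_on_def scaleC_fun_def by metis
  qed
  have scale: "\<epsilon> (\<lambda>p. fun_tens a b (p, q)) = b q * \<epsilon> a" "\<epsilon> (\<lambda>p. fun_tens b a (q, p)) = b q * \<epsilon> a"
    if "a \<in> A" for a b q
  proof -
    have "(\<lambda>p. fun_tens a b (p, q)) = b q *\<^sub>C a" "(\<lambda>p. fun_tens b a (q, p)) = b q *\<^sub>C a"
      by (simp_all add: fun_eq_iff fun_alg_simps)
    then show "\<epsilon> (\<lambda>p. fun_tens a b (p, q)) = b q * \<epsilon> a" "\<epsilon> (\<lambda>p. fun_tens b a (q, p)) = b q * \<epsilon> a"
      using \<epsilon> that by (simp_all add: linear_on_def scaleC_complex_def)
  qed
  have 1: "\<epsilon> a *\<^sub>C b = (\<lambda>q. \<epsilon> (\<lambda>p. fun_tens a b (p, q)))"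
    and 2: "\<epsilon> a *\<^sub>C b = (\<lambda>q. \<epsilon> (\<lambda>p. fun_tens b a (q, p)))" if "a \<in> A" for a b
    unfolding scale[OF that] by (simp_all add: fun_eq_iff fun_alg_simps)
  show "lift2 (\<lambda>u v. \<epsilon> u *\<^sub>C v) x = (\<lambda>q. \<epsilon> (\<lambda>p. x (p, q)))"
    by (subst lift2_fun[OF lin 1]) (simp_all add: x)
  show "lift2 (\<lambda>u v. \<epsilon> v *\<^sub>C u) x = (\<lambda>q. \<epsilon> (\<lambda>p. x (q, p)))"
    by (subst lift2_fun[OF lin 2]) (simp_all add: x)
qed

text \<open>A functional with these values at points sums the values of a function at the units, and
  here only the term at \<open>u\<close> is left.\<close>

lemma linear_unit_support:
  assumes \<epsilon>: "linear_on A UNIV \<epsilon>" "\<And>p. p \<in> G \<Longrightarrow> \<epsilon> (point p) = (if src p = p then 1 else 0)"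
    and f: "f \<in> A" and u: "u \<in> G" "src u = u"
    and zero: "\<And>p. p \<in> G \<Longrightarrow> src p = p \<Longrightarrow> p \<noteq> u \<Longrightarrow> f p = 0"
  shows "\<epsilon> f = (f u :: complex)"
proof -
  \<comment> \<open>Within G this is the indicator of the units. Off G its values are arbitrary,
    which does no harm since \<open>f\<close> vanishes there.\<close>
  let ?\<chi> = "\<lambda>p. if src p = p then 1 else (0::complex)"
  have "\<epsilon> f = \<epsilon> (?\<chi> * f)"
  proof (rule linear_on_fin_supp_fun_eqI[OF \<epsilon>(1) _ _ f])
    show "linear_on A UNIV (\<lambda>f. \<epsilon> (?\<chi> * f))"
      using \<epsilon>(1) by (auto simp: linear_on_def ring_distribs mult_scaleC_right)
    fix p assume p: "p \<in> G"
    have "?\<chi> * point p = ?\<chi> p *\<^sub>C point p"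
      by (auto simp: fun_eq_iff fun_alg_simps point_def)
    then have "\<epsilon> (?\<chi> * point p) = ?\<chi> p *\<^sub>C \<epsilon> (point p)"
      using \<epsilon>(1) p by (simp only: linear_on_def point_in)
    then show "\<epsilon> (point p) = \<epsilon> (?\<chi> * point p)"
      using \<epsilon>(2) p by (simp add: scaleC_complex_def)
  qed
  also have "?\<chi> * f = f u *\<^sub>C point u"
    using zero u fin_supp_fun_zero[OF f] by (auto simp: fun_eq_iff fun_alg_simps point_def)
  also have "\<epsilon> (f u *\<^sub>C point u) = f u"
    using \<epsilon> u by (simp add: linear_on_def scaleC_complex_def)
  finally show ?thesis .
qed

text \<open>The only unit u for which uq is defined is t(q), and the only one for which qu is
  defined is s(q). So each slice contributes a single value, and t(q)q = q = q s(q) turns it into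
  a(q) b(q).\<close>

lemma counitI:
  assumes \<epsilon>: "linear_on A UNIV \<epsilon>" "\<And>p. p \<in> G \<Longrightarrow> \<epsilon> (point p) = (if src p = p then 1 else 0)"
  shows "counit \<epsilon>"
  unfolding counit_def
proof (intro conjI ballI \<epsilon>(1))
  have \<epsilon>0: "\<epsilon> (\<lambda>p. 0) = 0"
    using linear_on_0[OF subspace_fin_supp_fun \<epsilon>(1)] by (simp add: zero_fun_def)
  fix a b assume ab: "a \<in> A" "b \<in> A"
  then have x: "t1 (fun_tens a b) \<in> A2" "t2 (fun_tens a b) \<in> A2" by simp_all
  show "lift2 (\<lambda>u v. \<epsilon> u *\<^sub>C v) (Delta1 a b) = a * b"
  proof
    fix q
    have "\<epsilon> (\<lambda>p. t1 (fun_tens a b) (p, q)) = a q * b q"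
    proof (cases "q \<in> G")
      case True
      then show ?thesis
        by (subst linear_unit_support[OF \<epsilon> slice_in(1)[OF x(1)], of "tgt q"])
          (auto simp: t_apply comp_ind_def)
    qed (use ab in \<open>simp add: t_apply comp_ind_def fin_supp_fun_zero \<epsilon>0\<close>)
    then show "lift2 (\<lambda>u v. \<epsilon> u *\<^sub>C v) (Delta1 a b) q = (a * b) q"
      using ab by (simp add: lift2_slice[OF \<epsilon>(1) x(1)])
  qed
  show "lift2 (\<lambda>u v. \<epsilon> v *\<^sub>C u) (Delta2 a b) = a * b"
  proof
    fix q
    have "\<epsilon> (\<lambda>p. t2 (fun_tens a b) (q, p)) = a q * b q"
    proof (cases "q \<in> G")
      case True
      then show ?thesis
        by (subst linear_unit_support[OF \<epsilon> slice_in(2)[OF x(2)], of "src q"])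
          (auto simp: t_apply comp_ind_def dest: src_tgt_units)
    qed (use ab in \<open>simp add: t_apply comp_ind_def fin_supp_fun_zero \<epsilon>0\<close>)
    then show "lift2 (\<lambda>u v. \<epsilon> v *\<^sub>C u) (Delta2 a b) q = (a * b) q"
      using ab by (simp add: lift2_slice[OF \<epsilon>(1) x(2)])
  qed
qed

text \<open>Since \<open>t1\<close> fixes the indicator of (p, s(p)), the counit identity for
  \<open>point p\<close> and \<open>point (src p)\<close>, evaluated at s(p), reads off \<epsilon>
  at \<open>point p\<close>. The result is the value of \<open>point p\<close> at s(p), which is 1
  exactly if p is a unit.\<close>

lemma counit_point:
  assumes \<epsilon>: "counit \<epsilon>" and p: "p \<in> G"
  shows "\<epsilon> (point p) = (if src p = p then 1 else 0)"
proof -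
  have lin: "linear_on A UNIV \<epsilon>" using \<epsilon> by (simp add: counit_def)
  have "\<forall>a\<in>A. \<forall>b\<in>A. lift2 (\<lambda>u v. \<epsilon> u *\<^sub>C v) (Delta1 a b) = a * b"
    using \<epsilon> unfolding counit_def by (elim conjE)
  then have "lift2 (\<lambda>u v. \<epsilon> u *\<^sub>C v) (Delta1 (point p) (point (src p))) = point p * point (src p)"
    using p by (simp only: point_in src_closed)
  moreover have "Delta1 (point p) (point (src p)) = point (p, src p)"
    using p by (simp add: t1_point)
  moreover have "lift2 (\<lambda>u v. \<epsilon> u *\<^sub>C v) (point (p, src p)) = (\<lambda>q. \<epsilon> (\<lambda>r. point (p, src p) (r, q)))"
    by (rule lift2_slice(1)[OF lin]) (use p in simp)
  ultimately have "(\<lambda>q. \<epsilon> (\<lambda>r. point (p, src p) (r, q))) = point p * point (src p)"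
    by (simp only:)
  from fun_cong[OF this, of "src p"] show ?thesis
    by (simp only: point_slice) (simp add: point_def)
qed

lemma ex_counit: "\<exists>\<epsilon>. counit \<epsilon>"
  by (rule linear_extension[of G "\<lambda>p. if src p = p then 1 else 0"]) (rule exI, rule counitI)

section \<open>The structure elements\<close>

lemma image_t1: "t1 ` A2 = (*) comp_ind ` A2"
proof
  show "t1 ` A2 \<subseteq> (*) comp_ind ` A2"
    using comp_ind_t1 t1_in by (metis image_subsetI imageI)
  show "(*) comp_ind ` A2 \<subseteq> t1 ` A2"
    using t1_r1 r1_in by (metis image_subsetI imageI)
qed

lemma image_t2: "t2 ` A2 = (*) comp_ind ` A2"
proof
  show "t2 ` A2 \<subseteq> (*) comp_ind ` A2"
    using comp_ind_t2 t2_in by (metis image_subsetI imageI)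
  show "(*) comp_ind ` A2 \<subseteq> t2 ` A2"
    using t2_r2 r2_in by (metis image_subsetI imageI)
qed

abbreviation E where "E \<equiv> mult_by A2 comp_ind"

lemma range_idempotent_E: "range_idempotent E"
proof -
  have "comp_ind * comp_ind = comp_ind"
    by (auto simp: fun_eq_iff comp_ind_def)
  moreover have "lact E ` A2 = (*) comp_ind ` A2" "ract E ` A2 = (*) comp_ind ` A2"
    "T1 ` A2 = t1 ` A2" "T2 ` A2 = t2 ` A2"
    by (auto intro!: image_cong)
  ultimately show ?thesis
    by (simp add: range_idempotent_def mult_by_in_multipliers image_t1 image_t2)
qed

text \<open>An idempotent function takes only the values 0 and 1. Equality of the ranges, tested on
  \<open>point t\<close>, shows that \<open>y\<close> and \<open>comp_ind\<close> vanish at the same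
  points of G x G.\<close>

lemma range_idempotent_unique:
  assumes "range_idempotent E'"
  shows "E' = E"
proof -
  define y where "y = coeff E'"
  have "E' \<in> multipliers A2" using assms by (simp add: range_idempotent_def)
  then have E': "E' = mult_by A2 y" unfolding y_def by (rule multiplier_eq_mult_by)
  have idem: "y t * y t = y t" if "t \<in> G \<times> G" for t
    using assms that by (auto simp: E' range_idempotent_def mult_by_eq_iff)
  have "lact E' ` A2 = (*) y ` A2" "T1 ` A2 = t1 ` A2"
    by (auto intro!: image_cong simp: E')
  then have img: "(*) y ` A2 = (*) comp_ind ` A2"
    using assms by (simp add: range_idempotent_def image_t1)
  have "y t = comp_ind t" if t: "t \<in> G \<times> G" for t
  proof -
    have "y * point t \<in> (*) comp_ind ` A2" "comp_ind * point t \<in> (*) y ` A2"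
      using img t by auto
    then obtain x x' where x: "y * point t = comp_ind * x" "comp_ind * point t = y * x'" by auto
    have "y t = comp_ind t * x t" "comp_ind t = y t * x' t"
      using fun_cong[OF x(1), of t] fun_cong[OF x(2), of t] by (simp_all add: point_def)
    moreover have "comp_ind t = 0 \<or> comp_ind t = 1"
      by (cases t) (simp add: comp_ind_def)
    moreover have "y t = 0 \<or> y t = 1" using idem[OF t] by simp
    ultimately show ?thesis by auto
  qed
  then show ?thesis unfolding E' by (rule mult_by_cong)
qed

text \<open>
  The extensions of \<open>\<Delta> \<otimes> \<iota>\<close> and \<open>\<iota> \<otimes> \<Delta>\<close> pull functions back along the multiplication in the first,
  respectively last, two variables.
\<close>

definition Delta_iota :: "('g \<times> 'g \<Rightarrow> complex) multiplier \<Rightarrow> ('g \<times> 'g \<times> 'g \<Rightarrow> complex) multiplier"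
  where "Delta_iota m = mult_by A3 (\<lambda>(p, q, r). comp_ind (p, q) * coeff m (pr p q, r))"

definition iota_Delta :: "('g \<times> 'g \<Rightarrow> complex) multiplier \<Rightarrow> ('g \<times> 'g \<times> 'g \<Rightarrow> complex) multiplier"
  where "iota_Delta m = mult_by A3 (\<lambda>(p, q, r). comp_ind (q, r) * coeff m (p, pr q r))"

lemma hom_Delta_iota: "multiplier_algebra_hom A2 A3 Delta_iota"
  unfolding multiplier_algebra_hom_def Delta_iota_def
  by (auto simp: mult_by_in_multipliers mult_by_eq_iff coeff_simps coeff_mtimes fun_alg_simps
      algebra_simps comp_ind_def)

lemma hom_iota_Delta: "multiplier_algebra_hom A2 A3 iota_Delta"
  unfolding multiplier_algebra_hom_def iota_Delta_def
  by (auto simp: mult_by_in_multipliers mult_by_eq_iff coeff_simps coeff_mtimes fun_alg_simps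
      algebra_simps comp_ind_def)

lemma extends_Delta_iota: "extends_Delta_iota E Delta_iota"
  unfolding extends_Delta_iota_def Delta_eq mone_eq_mult_by
  by (auto simp: hom_Delta_iota Delta_iota_def mult_by_eq_iff comp_ind_def)

lemma extends_iota_Delta: "extends_iota_Delta E iota_Delta"
  unfolding extends_iota_Delta_def Delta_eq mone_eq_mult_by
  by (auto simp: hom_iota_Delta iota_Delta_def mult_by_eq_iff comp_ind_def)

text \<open>Since s(pq) = s(q) and t(qr) = t(q), every multiplier in the condition is the indicator
  of the triples with s(p) = t(q) and s(q) = t(r).\<close>

lemma E_condition: "E_condition E"
  unfolding E_condition_def
proof (rule exI[of _ Delta_iota], rule exI[of _ iota_Delta], intro conjI)
  show "extends_Delta_iota E Delta_iota" "extends_iota_Delta E iota_Delta"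
    by (fact extends_Delta_iota extends_iota_Delta)+
  show "iota_Delta E = Delta_iota E"
    "Delta_iota E = mtimes (one_mtens E) (mtens_one E)"
    "mtimes (one_mtens E) (mtens_one E) = mtimes (mtens_one E) (one_mtens E)"
    by (auto simp: Delta_iota_def iota_Delta_def mult_by_eq_iff comp_ind_def)
qed

section \<open>The one-sided multipliers \<open>F1\<close> and \<open>F2\<close>\<close>

lemma F_multiplier_mult: "F_multiplier ((*) y)"
  by (auto simp: F_multiplier_def linear_on_def ring_distribs mult_scaleC_right fun_eq_iff)

text \<open>The factor \<open>E\<close> in the outer variables restricts to triples (u, v, w) with
  s(u) = t(w). There s(u) = s(v) holds exactly if s(v) = t(w), so \<open>src_ind\<close> at (u, v)
  agrees with \<open>comp_ind\<close> at (v, w).\<close>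

lemma F1_condition: "F1_condition E ((*) src_ind)"
  unfolding F1_condition_def
proof (intro conjI ballI F_multiplier_mult)
  fix a b c d assume abcd: "a \<in> A" "b \<in> A" "c \<in> A" "d \<in> A"
  have "lift2 (\<lambda>p q. tens_r (src_ind * fun_tens p b) (q * d)) =
      (\<lambda>x. if x \<in> A2 then \<lambda>(u, v, w). x (u, w) * b v * d w * src_ind (u, v) else 0)"
    by (rule lift2_fun) (use abcd in \<open>auto simp: linear_on_def fun_eq_iff fun_alg_simps algebra_simps\<close>)
  moreover have "lift2 (\<lambda>p q. tens_l p (lact (one_tens q) (lact E (fun_tens b d)))) =
      (\<lambda>x. if x \<in> A2 then \<lambda>(u, v, w). x (u, w) * b v * d w * comp_ind (v, w) else 0)"
    by (rule lift2_fun) (use abcd in \<open>auto simp: linear_on_def fun_eq_iff fun_alg_simps algebra_simps\<close>)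
  ultimately show "lift2 (\<lambda>p q. tens_r (src_ind * fun_tens p b) (q * d)) (ract E (fun_tens a c)) =
      lift2 (\<lambda>p q. tens_l p (lact (one_tens q) (lact E (fun_tens b d)))) (ract E (fun_tens a c))"
    using abcd by (auto simp: fun_eq_iff comp_ind_def src_ind_def fin_supp_fun_zero)
qed

text \<open>Where s(u) = t(w), the conditions t(v) = t(w) and s(u) = t(v) are equivalent, so
  \<open>tgt_ind\<close> at (v, w) agrees with \<open>comp_ind\<close> at (u, v).\<close>

lemma F2_condition: "F2_condition E ((*) tgt_ind)"
  unfolding F2_condition_def
proof (intro conjI ballI F_multiplier_mult)
  fix a b c d assume abcd: "a \<in> A" "b \<in> A" "c \<in> A" "d \<in> A"
  have "lift2 (\<lambda>p q. tens_l (d * p) (tgt_ind * fun_tens b q)) =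
      (\<lambda>x. if x \<in> A2 then \<lambda>(u, v, w). x (u, w) * b v * d u * tgt_ind (v, w) else 0)"
    by (rule lift2_fun) (use abcd in \<open>auto simp: linear_on_def fun_eq_iff fun_alg_simps algebra_simps\<close>)
  moreover have "lift2 (\<lambda>p q. tens_r (ract (tens_one p) (ract E (fun_tens d b))) q) =
      (\<lambda>x. if x \<in> A2 then \<lambda>(u, v, w). x (u, w) * b v * d u * comp_ind (u, v) else 0)"
    by (rule lift2_fun) (use abcd in \<open>auto simp: linear_on_def fun_eq_iff fun_alg_simps algebra_simps\<close>)
  ultimately show "lift2 (\<lambda>p q. tens_l (d * p) (tgt_ind * fun_tens b q)) (lact E (fun_tens a c)) =
      lift2 (\<lambda>p q. tens_r (ract (tens_one p) (ract E (fun_tens d b))) q) (lact E (fun_tens a c))"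
    using abcd by (auto simp: fun_eq_iff comp_ind_def tgt_ind_def fin_supp_fun_zero)
qed

section \<open>The kernels of \<open>T1\<close> and \<open>T2\<close>\<close>

lemma diff_mult_in_span:
  assumes "x \<in> A2"
  shows "x - y * x \<in> cvec.span {fun_tens a b - y * fun_tens a b | a b. a \<in> A \<and> b \<in> A}" (is "_ \<in> ?S")
proof (rule fin_supp_fun_induct[OF assms, where P = "\<lambda>x. x - y * x \<in> ?S"])
  show "0 - y * 0 \<in> ?S" by (simp add: cvec.span_zero)
  fix c t x assume t: "t \<in> G \<times> G" and x: "x - y * x \<in> ?S"
  obtain p q where pq: "t = (p, q)" "p \<in> G" "q \<in> G" using t by blast
  \<comment> \<open>The indicator of a pair is an elementary tensor, so its difference is one of the
    generators.\<close>
  have "point t - y * point t = fun_tens (point p) (point q) - y * fun_tens (point p) (point q)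
      \<and> point p \<in> A \<and> point q \<in> A"
    using pq by simp
  then have "point t - y * point t \<in> ?S"
    by (intro cvec.span_base CollectI exI)
  then have "c *\<^sub>C (point t - y * point t) + (x - y * x) \<in> ?S"
    using x by (intro cvec.span_add cvec.span_scale)
  then show "(c *\<^sub>C point t + x) - y * (c *\<^sub>C point t + x) \<in> ?S"
    by (simp add: ring_distribs mult_scaleC_right cvec.scale_right_diff_distrib algebra_simps)
qed

text \<open>If L x = 0, then y x = R (L x) = 0 and x = x - y x lies in the span. Conversely, L (y x)
  = L x says that L kills every x - y x.\<close>

lemma kernel_eq_span:
  assumes L: "linear_on A2 A2 L" and y: "\<And>x. L (y * x) = L x" and R: "\<And>x. R (L x) = y * x"
    and R0: "R 0 = 0"
  shows "{x \<in> A2. L x = 0} = cvec.span {fun_tens a b - y * fun_tens a b | a b. a \<in> A \<and> b \<in> A}"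
proof
  show "{x \<in> A2. L x = 0} \<subseteq> cvec.span {fun_tens a b - y * fun_tens a b | a b. a \<in> A \<and> b \<in> A}"
  proof
    fix x assume x: "x \<in> {x \<in> A2. L x = 0}"
    then have "x - y * x = x" using R[of x] R0 by simp
    then show "x \<in> cvec.span {fun_tens a b - y * fun_tens a b | a b. a \<in> A \<and> b \<in> A}"
      using diff_mult_in_span[of x y] x by simp
  qed
  have "cvec.subspace {x \<in> A2. L x = 0}"
    using L linear_on_0[OF subspace_fin_supp_fun L]
    by (intro cvec.subspaceI) (simp_all add: linear_on_def)
  moreover have "L (x - y * x) = 0" if "x \<in> A2" for x
  proof -
    have "L (x - y * x) + L (y * x) = L (x - y * x + y * x)"
      using L that unfolding linear_on_def by (metis fin_supp_fun_diff fin_supp_fun_mult(1))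
    then show ?thesis by (simp add: y)
  qed
  ultimately show "cvec.span {fun_tens a b - y * fun_tens a b | a b. a \<in> A \<and> b \<in> A} \<subseteq> {x \<in> A2. L x = 0}"
    by (intro cvec.span_minimal) auto
qed

lemma kernel_conditions: "kernel_conditions ((*) src_ind) ((*) tgt_ind)"
proof -
  have "{x \<in> A2. T1 x = 0} = {x \<in> A2. t1 x = 0}" "{x \<in> A2. T2 x = 0} = {x \<in> A2. t2 x = 0}" by auto
  moreover have "r1 0 = 0" "r2 0 = 0" by (auto simp: fun_eq_iff t_apply)
  note kernel_eq_span[OF linear_t1 t1_src_ind r1_t1 this(1)]
    kernel_eq_span[OF linear_t2 t2_tgt_ind r2_t2 this(2)]
  ultimately show ?thesis by (simp only: kernel_conditions_def)
qed

lemma structure_elements: "structure_elements E ((*) src_ind) ((*) tgt_ind)"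
  by (simp add: structure_elements_def range_idempotent_E E_condition F1_condition F2_condition
      kernel_conditions)

theorem weak_multiplier_Hopf_algebra: "weak_multiplier_Hopf_algebra"
  unfolding weak_multiplier_Hopf_algebra_def
  using tensor_powers nondegenerate_fin_supp_fun idempotent_fin_supp_fun full_coproduct ex_counit
    structure_elements
  by blast

section \<open>The antipode\<close>

lemma lift2_tens:
  assumes "bilinear_on A UNIV \<beta>" "a \<in> A" "b \<in> A"
  shows "lift2 \<beta> (fun_tens a b) = \<beta> a b"
  using lift2_sum[OF tensor_square assms(1), of 1 "\<lambda>_. a" "\<lambda>_. b"] assms by simp

text \<open>The module property confines the image of \<open>point (p, q)\<close> to the pair (p,
  q), so a single number is unknown. The defining equation of \<open>F1\<close>, with the third
  variable at s(p), determines it.\<close>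

lemma F1_unique:
  assumes F: "F1_condition E F" and x: "x \<in> A2"
  shows "F x = src_ind * x"
proof (rule linear_on_fin_supp_fun_eqI[OF _ _ _ x])
  show lin: "linear_on A2 A2 F" using F by (simp add: F1_condition_def F_multiplier_def)
  show "linear_on A2 A2 ((*) src_ind)"
    using F_multiplier_mult by (simp add: F_multiplier_def)
  fix t assume "t \<in> G \<times> G"
  then obtain p q where t: "t = (p, q)" and pq: "p \<in> G" "q \<in> G" by blast
  have in2: "F (fun_tens a b) \<in> A2" if "a \<in> A" "b \<in> A" for a b
    using lin that by (simp add: linear_on_def)
  have idem: "point r * point r = point r" for r :: 'g
    by (auto simp: fun_eq_iff point_def)
  have "F (fun_tens (point p * point p) (point q * point q)) =
      ract (one_tens (point q)) (lact (tens_one (point p)) (F (fun_tens (point p) (point q))))"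
    using F pq by (simp only: F1_condition_def F_multiplier_def point_in)
  then have loc: "F (point t) = (\<lambda>(u, v). point q v) * ((\<lambda>(u, v). point p u) * F (point t))"
    using pq in2[of "point p" "point q"] by (simp add: idem t)
  \<comment> \<open>\<open>F\<close> is known only to be linear, so no closed formula for this lift
    is at hand; bilinearity is enough to evaluate it on an elementary tensor.\<close>
  have bil: "bilinear_on A UNIV (\<lambda>a b. tens_r (F (fun_tens a (point q))) (b * point (src p)))"
  proof -
    have "fun_tens (a + a') (point q) = fun_tens a (point q) + fun_tens a' (point q)"
      "fun_tens (k *\<^sub>C a) (point q) = k *\<^sub>C fun_tens a (point q)" for a a' k
      by (simp_all add: fun_eq_iff fun_tens_def fun_alg_simps algebra_simps)
    then have "F (fun_tens (a + a') (point q)) = F (fun_tens a (point q)) + F (fun_tens a' (point q))"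
      "F (fun_tens (k *\<^sub>C a) (point q)) = k *\<^sub>C F (fun_tens a (point q))"
      if "a \<in> A" "a' \<in> A" for a a' k
      using lin that pq by (simp_all add: linear_on_def)
    then show ?thesis
      unfolding bilinear_on_def linear_on_def
      using pq in2 by (auto simp: fun_eq_iff fun_alg_simps algebra_simps)
  qed
  have R: "lift2 (\<lambda>a b. tens_l a (lact (one_tens b) (lact E (fun_tens (point q) (point (src p)))))) =
      (\<lambda>x. if x \<in> A2 then \<lambda>(u, v, w). x (u, w) * point q v * point (src p) w * comp_ind (v, w) else 0)"
    by (rule lift2_fun)
      (use pq in \<open>auto simp: linear_on_def fun_eq_iff fun_alg_simps algebra_simps simp del: fun_tens_point\<close>)
  \<comment> \<open>The pair (p, s(p)) is composable, so \<open>E\<close> fixes its indicator. This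
    is why s(p) is chosen for the third variable.\<close>
  have e: "ract E (fun_tens (point p) (point (src p))) = fun_tens (point p) (point (src p))"
    using pq by (simp, auto simp: fun_eq_iff comp_ind_def point_def)
  have "lift2 (\<lambda>a b. tens_r (F (fun_tens a (point q))) (b * point (src p)))
        (ract E (fun_tens (point p) (point (src p)))) =
      lift2 (\<lambda>a b. tens_l a (lact (one_tens b) (lact E (fun_tens (point q) (point (src p))))))
        (ract E (fun_tens (point p) (point (src p))))"
    using F pq by (simp only: F1_condition_def point_in src_closed)
  \<comment> \<open>At (p, q, s(p)) the right side is \<open>comp_ind\<close> at (q, s(p)), which
    tests s(q) = s(p) and thus equals \<open>src_ind\<close> at (p, q).\<close>
  then have "tens_r (F (fun_tens (point p) (point q))) (point (src p) * point (src p)) (p, q, src p) =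
      (\<lambda>(u, v, w). point (p, src p) (u, w) * point q v * point (src p) w * comp_ind (v, w)) (p, q, src p)"
    unfolding e R using pq by (subst (asm) lift2_tens[OF bil]) simp_all
  then have val: "F (point t) t = src_ind t"
    using pq in2[of "point p" "point q"]
    by (simp add: t idem) (simp add: point_def comp_ind_def src_ind_def eq_commute)
  show "F (point t) = src_ind * point t"
  proof
    fix s :: "'g \<times> 'g"
    obtain u v where s: "s = (u, v)" by (cases s)
    show "F (point t) s = (src_ind * point t) s"
      using fun_cong[OF loc, of s] val by (cases "s = t") (auto simp: s t point_def split: if_splits)
  qed
qed

lemma is_R1_r1: "is_R1 E ((*) src_ind) r1"
  by (auto simp: is_R1_def linear_r1 t1_r1 r1_t1 comp_ind_t1 r1_comp_ind t1_src_ind)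

text \<open>A generalised inverse R of T with prescribed TR and RT is unique. Once \<open>E'\<close>
  and \<open>F1\<close> are identified, \<open>R x\<close> equals \<open>R (t1 (R x))\<close>, hence
  \<open>R (t1 (r1 x))\<close>, hence \<open>src_ind * r1 x\<close>, which is
  \<open>r1 x\<close>.\<close>

lemma R1_unique:
  assumes "structure_elements E' F1 F2" "is_R1 E' F1 R" and x: "x \<in> A2"
  shows "R x = r1 x"
proof -
  have E': "E' = E"
    using assms range_idempotent_unique by (simp add: structure_elements_def)
  have F1: "F1 z = src_ind * z" if "z \<in> A2" for z
  proof (rule F1_unique[OF _ that])
    show "F1_condition E F1" using assms by (simp add: structure_elements_def E')
  qed
  have lin: "linear_on A2 A2 R" and R: "\<And>z. z \<in> A2 \<Longrightarrow> R (T1 (R z)) = R z"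
    and TR: "\<And>a b. a \<in> A \<Longrightarrow> b \<in> A \<Longrightarrow> T1 (R (fun_tens a b)) = comp_ind * fun_tens a b"
    and RT: "\<And>a b. a \<in> A \<Longrightarrow> b \<in> A \<Longrightarrow> R (T1 (fun_tens a b)) = src_ind * fun_tens a b"
    using assms(2) by (simp_all add: is_R1_def E' F1)
  have in2: "R z \<in> A2" if "z \<in> A2" for z using lin that by (simp add: linear_on_def)
  have mult: "linear_on A2 A2 ((*) y)" for y
    using F_multiplier_mult by (simp add: F_multiplier_def)
  have TR': "t1 (R z) = comp_ind * z" if "z \<in> A2" for z
  proof (rule linear_on_fin_supp_fun_eqI[OF _ mult _ that])
    show "linear_on A2 A2 (\<lambda>z. t1 (R z))"
      using lin linear_t1 by (simp add: linear_on_def)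
    fix t assume "t \<in> G \<times> G"
    then obtain p q where "t = (p, q)" "p \<in> G" "q \<in> G" by blast
    then show "t1 (R (point t)) = comp_ind * point t"
      using TR[of "point p" "point q"] in2 by simp
  qed
  have RT': "R (t1 z) = src_ind * z" if "z \<in> A2" for z
  proof (rule linear_on_fin_supp_fun_eqI[OF _ mult _ that])
    show "linear_on A2 A2 (\<lambda>z. R (t1 z))"
      using lin linear_t1 by (simp add: linear_on_def)
    fix t assume "t \<in> G \<times> G"
    then obtain p q where "t = (p, q)" "p \<in> G" "q \<in> G" by blast
    then show "R (t1 (point t)) = src_ind * point t"
      using RT[of "point p" "point q"] in2 by simp
  qed
  have "R x = R (t1 (R x))" using R[OF x] in2[OF x] by simp
  also have "\<dots> = R (t1 (r1 x))" by (simp only: TR'[OF x] t1_r1)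
  also have "\<dots> = r1 x" using x by (simp add: RT' src_ind_r1)
  finally show ?thesis .
qed

lemma counit_r1:
  assumes \<epsilon>: "counit \<epsilon>" and fg: "f \<in> A" "g \<in> A"
  shows "lift2 (\<lambda>u v. \<epsilon> u *\<^sub>C v) (r1 (fun_tens f g)) = (\<lambda>p. if p \<in> G then f (inv p) else 0) * g"
proof
  fix q
  have lin: "linear_on A UNIV \<epsilon>" using \<epsilon> by (simp add: counit_def)
  have \<epsilon>0: "\<epsilon> (\<lambda>p. 0) = 0"
    using linear_on_0[OF subspace_fin_supp_fun lin] by (simp add: zero_fun_def)
  have x: "r1 (fun_tens f g) \<in> A2" using fg by simp
  have "\<epsilon> (\<lambda>p. r1 (fun_tens f g) (p, q)) = (if q \<in> G then f (inv q) else 0) * g q"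
  proof (cases "q \<in> G")
    case True
    then have "\<epsilon> (\<lambda>p. r1 (fun_tens f g) (p, q)) = r1 (fun_tens f g) (src q, q)"
      by (intro linear_unit_support[OF lin counit_point[OF \<epsilon>] slice_in(1)[OF x, of q], of "src q"])
        (auto simp: t_apply src_ind_def)
    moreover have "pr (src q) (inv q) = inv q" using True by (metis inv_closed tgt_inv tgt_pr_left)
    ultimately show ?thesis using True by (simp add: t_apply src_ind_def)
  qed (simp add: t_apply src_ind_def \<epsilon>0)
  then show "lift2 (\<lambda>u v. \<epsilon> u *\<^sub>C v) (r1 (fun_tens f g)) q = ((\<lambda>p. if p \<in> G then f (inv p) else 0) * g) q"
    by (simp only: lift2_slice(1)[OF lin x] times_fun_apply)
qed

text \<open>The description is definite because every admissible \<open>R\<close> agrees with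
  \<open>r1\<close> on \<open>A2\<close> and \<open>counit_r1\<close> gives the same value for every
  counit.\<close>

theorem antipode_eq:
  assumes fg: "f \<in> A" "g \<in> A"
  shows "antipode f g = (\<lambda>p. if p \<in> G then f (inv p) else 0) * g"
  unfolding antipode_def
proof (rule the_equality)
  obtain \<epsilon> where "counit \<epsilon>" using ex_counit by blast
  then show "\<exists>\<epsilon> E F1 F2 R. counit \<epsilon> \<and> structure_elements E F1 F2 \<and> is_R1 E F1 R \<and>
      (\<lambda>p. if p \<in> G then f (inv p) else 0) * g = lift2 (\<lambda>u v. \<epsilon> u *\<^sub>C v) (R (fun_tens f g))"
    using structure_elements is_R1_r1 counit_r1[OF _ fg, symmetric] by (intro exI conjI)
next
  fix w
  assume "\<exists>\<epsilon> E F1 F2 R. counit \<epsilon> \<and> structure_elements E F1 F2 \<and> is_R1 E F1 R \<and>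
      w = lift2 (\<lambda>u v. \<epsilon> u *\<^sub>C v) (R (fun_tens f g))"
  then obtain \<epsilon> E' F1 F2 R where \<epsilon>: "counit \<epsilon>" and S: "structure_elements E' F1 F2" "is_R1 E' F1 R"
    and w: "w = lift2 (\<lambda>u v. \<epsilon> u *\<^sub>C v) (R (fun_tens f g))" by (elim exE conjE)
  have "R (fun_tens f g) = r1 (fun_tens f g)" by (rule R1_unique[OF S]) (simp add: fg)
  then show "w = (\<lambda>p. if p \<in> G then f (inv p) else 0) * g"
    using w counit_r1[OF \<epsilon> fg] by simp
qed

end

theorem proposition4p3:
  fixes G :: "'g set"
    and pr :: "'g \<Rightarrow> 'g \<Rightarrow> 'g"
    and src tgt inv :: "'g \<Rightarrow> 'g"
  assumes "groupoid G pr src tgt inv"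
  shows "let A = fin_supp_fun G;
             A2 = fin_supp_fun (G \<times> G);
             A3 = fin_supp_fun (G \<times> G \<times> G);
             \<Delta> = groupoid_coproduct G pr src tgt
         in coproduct_data.weak_multiplier_Hopf_algebra A A2 fun_tens A3 fun_tens3 \<Delta> \<and>
            (\<forall>f\<in>A. \<forall>g\<in>A. coproduct_data.antipode A A2 fun_tens A3 fun_tens3 \<Delta> f g =
              (\<lambda>p. if p \<in> G then f (inv p) else 0) * g)"
proof -
  interpret groupoid G pr src tgt inv by (fact assms)
  show ?thesis
    unfolding Let_def using weak_multiplier_Hopf_algebra antipode_eq by blast
qed

end
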